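(* Every countable subgroup $H$ of an infinite compact abelian group $G$ is $\mathbf{g}$-closed, i.e. $H$ is representable as the intersection of a family of basic $\mathbf{g}$-closed subgroups of $G$.
   Context: $\mathbb{T}=\mathbb{R}/\mathbb{Z}$, written additively. $\widehat{G}$ is the group of all continuous homomorphisms $\chi: G\to\mathbb{T}$. Subgroups need not be topologically closed. For a sequence $(\chi_n)_{n=1}^\infty$ in $\widehat{G}$ put $s_{(\chi_n)_{n=1}^\infty}(G):=\{\alpha\in G:\lim_{n\to\infty}\chi_n(\alpha)=0\}$. Subgroups of $G$ of this form are called basic $\mathbf{g}$-closed. A subgroup of $G$ is called $\mathbf{g}$-closed if it is representable as the intersection of basic $\mathbf{g}$-closed subgroups. *)

theory Defs
  imports Complex_Main "HOL-Library.Countable_Set"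
begin

quotient_type real_mod_Z = real / "\<lambda>x y. x - y \<in> \<int>"
  morphisms rep_mod_Z class_mod_Z
proof (rule equivpI)
  show "reflp (\<lambda>x y. (x::real) - y \<in> \<int>)"
    by (simp add: reflp_def)
  show "symp (\<lambda>x y. (x::real) - y \<in> \<int>)"
    by (metis (mono_tags, lifting) Ints_minus minus_diff_eq sympI)
  show "transp (\<lambda>x y. (x::real) - y \<in> \<int>)"
  proof (rule transpI)
    fix x y z :: real
    assume "x - y \<in> \<int>" "y - z \<in> \<int>"
    then have "(x - y) + (y - z) \<in> \<int>" by (rule Ints_add)
    then show "x - z \<in> \<int>" by simp
  qed
qed

instantiation real_mod_Z :: ab_group_add
begin

lift_definition zero_real_mod_Z :: real_mod_Z is "0 :: real" .

lift_definition plus_real_mod_Z :: "real_mod_Z \<Rightarrow> real_mod_Z \<Rightarrow> real_mod_Z" is "(+)"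
  by (metis Ints_add add_diff_add)

lift_definition uminus_real_mod_Z :: "real_mod_Z \<Rightarrow> real_mod_Z" is "uminus"
  by (metis Ints_minus minus_diff_minus)

lift_definition minus_real_mod_Z :: "real_mod_Z \<Rightarrow> real_mod_Z \<Rightarrow> real_mod_Z" is "(-)"
  by (metis Ints_diff diff_diff_eq2 diff_add_eq add_diff_eq diff_diff_eq add.commute)

instance
  by standard (transfer; simp)+

end

text \<open>The quotient topology induced by the projection from the reals.\<close>

instantiation real_mod_Z :: topological_space
begin

definition open_real_mod_Z :: "real_mod_Z set \<Rightarrow> bool" where
  "open_real_mod_Z U \<longleftrightarrow> open (class_mod_Z -` U)"

instance
proof
  show "open (UNIV :: real_mod_Z set)"
    by (simp add: open_real_mod_Z_def)
  show "open (S \<inter> T)" if "open S" "open T" for S T :: "real_mod_Z set"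
    using that by (simp add: open_real_mod_Z_def open_Int)
  show "open (\<Union>K)" if "\<forall>S\<in>K. open S" for K :: "real_mod_Z set set"
    using that by (auto simp: open_real_mod_Z_def vimage_Union)
qed

end

definition is_subgroup :: "'a::ab_group_add set \<Rightarrow> bool" where
  "is_subgroup H \<longleftrightarrow>
     0 \<in> H \<and> (\<forall>x\<in>H. \<forall>y\<in>H. x + y \<in> H) \<and> (\<forall>x\<in>H. - x \<in> H)"

definition characters :: "('a::topological_ab_group_add \<Rightarrow> real_mod_Z) set" where
  "characters = {\<chi>. continuous_on UNIV \<chi> \<and> (\<forall>x y. \<chi> (x + y) = \<chi> x + \<chi> y)}"

definition null_subgroup ::
    "(nat \<Rightarrow> 'a::topological_ab_group_add \<Rightarrow> real_mod_Z) \<Rightarrow> 'a set" where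
  "null_subgroup \<chi> = {\<alpha>. (\<lambda>n. \<chi> n \<alpha>) \<longlonglongrightarrow> 0}"

definition basic_g_closed :: "'a::topological_ab_group_add set \<Rightarrow> bool" where
  "basic_g_closed H \<longleftrightarrow> (\<exists>\<chi>. (\<forall>n. \<chi> n \<in> characters) \<and> H = null_subgroup \<chi>)"

text \<open>Allowing the empty family adds nothing: its intersection is the whole group, which is
  the basic g-closed subgroup given by the constant sequence of zero characters.\<close>

definition g_closed :: "'a::topological_ab_group_add set \<Rightarrow> bool" where
  "g_closed H \<longleftrightarrow>
     is_subgroup H \<and> (\<exists>\<F>. (\<forall>B\<in>\<F>. basic_g_closed B) \<and> H = \<Inter>\<F>)"

end

theory Submission
  imports Defs "HOL-Analysis.Analysis"
begin

text \<open>Fix \<open>x \<notin> H\<close>. It suffices to find, for every finite \<open>S \<subseteq> H\<close> and \<open>d > 0\<close>, a character that is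
  \<open>d\<close>-close to \<open>1\<close> on \<open>S\<close> but far from \<open>1\<close> at \<open>x\<close>: enumerating \<open>H\<close> then gives a sequence of
  characters that converges to \<open>1\<close> on \<open>H\<close> but not at \<open>x\<close>. If there were no such character, a
  trigonometric polynomial with frequencies in \<open>H\<close> that is concentrated near the trivial character
  of \<open>S\<close> would correlate with evaluation at \<open>x\<close>, contradicting the orthogonality of \<open>x\<close> to \<open>H\<close>.

  That orthogonality needs characters to separate points. Averages of translates of a
  continuous function become uniformly constant, which gives an invariant mean. With it, maximize
  \<open>mean |h (x + g) - h x|\<^sup>2\<close> over the normalized autocorrelations \<open>h\<close> of continuous functions. This is a
  convex quadratic functional, and a normalized autocorrelation is, for every \<open>y\<close> and \<open>|a| = 1\<close>, a
  convex combination of those of \<open>u \<plusminus> a u(\<sqdot> + y)\<close>. Hence near-maximizers are nearly multiplicative,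
  and a nearly multiplicative continuous function can be corrected to a character, which is
  nontrivial at \<open>g\<close> because the supremum is positive.\<close>

section \<open>An invariant mean\<close>

text \<open>Lists rather than sets, since repetitions act as weights: an average of averages is then
  again an average, over the list of all sums \<open>a + b\<close>.\<close>

definition avg :: "'a::ab_group_add list \<Rightarrow> ('a \<Rightarrow> real) \<Rightarrow> 'a \<Rightarrow> real" where
  "avg as f x = (\<Sum>a\<leftarrow>as. f (x + a)) / real (length as)"

lemma sum_list_swap:
  fixes f :: "'b \<Rightarrow> 'c \<Rightarrow> 'd::comm_monoid_add"
  shows "(\<Sum>a\<leftarrow>as. \<Sum>b\<leftarrow>bs. f a b) = (\<Sum>b\<leftarrow>bs. \<Sum>a\<leftarrow>as. f a b)"
  by (induction as) (simp_all add: sum_list_addf)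

lemma avg_single [simp]: "avg [a] f x = f (x + a)"
  by (simp add: avg_def)

lemma avg_avg: "avg as (avg bs f) x = avg (concat (map (\<lambda>a. map ((+) a) bs) as)) f x"
proof -
  have "(\<Sum>a\<leftarrow>as. \<Sum>b\<leftarrow>bs. f (x + a + b)) = (\<Sum>c\<leftarrow>concat (map (\<lambda>a. map ((+) a) bs) as). f (x + c))"
    by (induction as) (simp_all add: comp_def add.assoc)
  moreover have "length (concat (map (\<lambda>a. map ((+) a) bs) as)) = length as * length bs"
    by (induction as) simp_all
  ultimately show ?thesis
    by (simp add: avg_def divide_inverse sum_list_mult_const)
qed

text \<open>Commutativity of the group enters here; it is what makes two nearly constant averages of
  \<open>f\<close> approximate the same constant.\<close>

lemma avg_commute: "avg as (avg bs f) x = avg bs (avg as f) x"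
  unfolding avg_def using sum_list_swap[of "\<lambda>a b. f (x + a + b)" bs as]
  by (simp add: divide_inverse sum_list_mult_const add_ac)

lemma avg_ge:
  assumes "as \<noteq> []" "\<And>x. m \<le> f x" shows "m \<le> avg as f x"
proof -
  have "(\<Sum>a\<leftarrow>as. m) \<le> (\<Sum>a\<leftarrow>as. f (x + a))"
    by (intro sum_list_mono assms)
  then show ?thesis
    using assms(1) by (simp add: avg_def sum_list_triv field_simps)
qed

lemma avg_uminus: "avg as (\<lambda>x. - f x) x = - avg as f x"
proof -
  have "(\<Sum>a\<leftarrow>as. - f (x + a)) = - (\<Sum>a\<leftarrow>as. f (x + a))"
    by (induction as) simp_all
  then show ?thesis by (simp add: avg_def)
qed

lemma avg_le:
  assumes "as \<noteq> []" "\<And>x. f x \<le> m" shows "avg as f x \<le> m"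
  using avg_ge[of as "-m" "\<lambda>x. - f x" x] assms by (simp add: avg_uminus)

lemma avg_add: "avg as (\<lambda>x. f x + g x) x = avg as f x + avg as g x"
  by (simp add: avg_def sum_list_addf add_divide_distrib)

lemma avg_scale: "avg as (\<lambda>x. c * f x) x = c * avg as f x"
  by (simp add: avg_def sum_list_const_mult)

text \<open>Continuity of \<open>f (x + t)\<close> in both variables at \<open>t = 0\<close> becomes
  uniform in \<open>x\<close> by compactness.\<close>

lemma uniform_shift:
  fixes f :: "'a::topological_ab_group_add \<Rightarrow> 'b::metric_space"
  assumes "compact (UNIV :: 'a set)" "continuous_on UNIV f" "e > 0"
  obtains U where "open U" "0 \<in> U" "\<And>t x. t \<in> U \<Longrightarrow> dist (f (x + t)) (f x) \<le> e"
proof -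
  have "continuous_on (UNIV \<times> UNIV) (\<lambda>(t, x). f (x + t))"
    unfolding split_def by (intro continuous_on_compose2[OF assms(2)] continuous_intros) auto
  then obtain U where U: "0 \<in> U" "open U" "\<forall>t\<in>U \<inter> UNIV. \<forall>x\<in>UNIV.
      dist ((\<lambda>(t, x). f (x + t)) (t, x)) ((\<lambda>(t, x). f (x + t)) (0, x)) \<le> e"
    by (rule continuous_on_prod_compactE[OF _ assms(1) UNIV_I assms(3)])
  show ?thesis by (rule that[OF U(2,1)]) (use U(3) in simp)
qed

lemma finite_translates:
  fixes U :: "'a::topological_ab_group_add set"
  assumes "compact (UNIV :: 'a set)" "open U" "u \<in> U"
  obtains as where "as \<noteq> []" "\<And>x. \<exists>a\<in>set as. x + a \<in> U"
proof -
  have "open ((\<lambda>x. x + a) -` U)" for a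
    by (intro open_vimage assms continuous_intros)
  moreover have "UNIV \<subseteq> (\<Union>a\<in>UNIV. (\<lambda>x. x + a) -` U)"
  proof
    fix x show "x \<in> (\<Union>a\<in>UNIV. (\<lambda>x. x + a) -` U)"
      using assms(3) by (intro UN_I[of "u - x"]) auto
  qed
  ultimately obtain C where C: "finite C" "UNIV \<subseteq> (\<Union>a\<in>C. (\<lambda>x. x + a) -` U)"
    by (rule compactE_image[OF assms(1), of UNIV "\<lambda>a. (\<lambda>x. x + a) -` U"])
  obtain as where "set as = C" using finite_list[OF C(1)] by auto
  with C(2) show ?thesis by (intro that[of as]) auto
qed

section \<open>Existence of the mean: averages become nearly constant\<close>

lemma continuous_bounded:
  fixes f :: "'a::topological_space \<Rightarrow> real"
  assumes "compact (UNIV :: 'a set)" "continuous_on UNIV f"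
  obtains B where "\<And>x. \<bar>f x\<bar> \<le> B"
  using compact_imp_bounded[OF compact_continuous_image[OF assms(2,1)]]
  unfolding bounded_iff by auto

text \<open>For continuous \<open>f\<close> on a compact group this is the normalized Haar integral.
  The supremum of lower bounds suffices because the averages of such \<open>f\<close> become nearly
  constant.\<close>

definition mean :: "('a::ab_group_add \<Rightarrow> real) \<Rightarrow> real" where
  "mean f = Sup {m. \<exists>as. as \<noteq> [] \<and> (\<forall>x. m \<le> avg as f x)}"

text \<open>If \<open>m\<close> bounds an average over \<open>bs\<close> from below, averaging once
  more over \<open>as\<close> and commuting the two averages compares \<open>m\<close> with
  \<open>avg as f\<close>.\<close>

lemma mean_close:
  assumes f: "\<And>x. \<bar>f x\<bar> \<le> B"
    and as: "as \<noteq> []" and osc: "\<And>x y. avg as f x - avg as f y \<le> r"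
  shows "\<bar>avg as f x - mean f\<bar> \<le> r"
proof -
  let ?S = "{m. \<exists>as. as \<noteq> [] \<and> (\<forall>x. m \<le> avg as f x)}"
  have mem: "avg as f x - r \<in> ?S"
    using as osc[of x] by (auto simp: algebra_simps intro!: exI[of _ as])
  have upper: "m \<le> avg as f x + r" if "m \<in> ?S" for m
  proof -
    from that obtain bs where bs: "bs \<noteq> []" "\<And>x. m \<le> avg bs f x" by auto
    have "m \<le> avg as (avg bs f) 0" by (intro avg_ge as bs)
    also have "\<dots> = avg bs (avg as f) 0" by (rule avg_commute)
    also have "\<dots> \<le> avg as f x + r"
    proof (rule avg_le[OF bs(1)])
      show "avg as f y \<le> avg as f x + r" for y using osc[of y x] by linarith
    qed
    finally show ?thesis .
  qed
  have "avg as f x - r \<le> mean f"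
    unfolding mean_def by (intro cSup_upper[OF mem] bdd_aboveI[of _ "avg as f x + r"] upper)
  moreover have "mean f \<le> avg as f x + r"
    unfolding mean_def using mem by (intro cSup_least upper) auto
  ultimately show ?thesis by auto
qed

lemma mean_eqI:
  assumes f: "\<And>x. \<bar>f x\<bar> \<le> B"
    and c: "\<And>e. e > 0 \<Longrightarrow> \<exists>as. as \<noteq> [] \<and> (\<forall>x. \<bar>avg as f x - c\<bar> \<le> e)"
  shows "mean f = c"
proof -
  have "\<bar>c - mean f\<bar> \<le> e" if e: "e > 0" for e
  proof -
    obtain as where as: "as \<noteq> []" "\<And>x. \<bar>avg as f x - c\<bar> \<le> e/3"
      using c[of "e/3"] e by (metis divide_pos_pos zero_less_numeral)
    have "\<bar>avg as f 0 - mean f\<bar> \<le> 2 * e/3"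
    proof (rule mean_close[OF f as(1)])
      show "avg as f x - avg as f y \<le> 2 * e / 3" for x y
        using as(2)[of x] as(2)[of y] by linarith
    qed
    then show ?thesis using as(2)[of 0] by linarith
  qed
  then show ?thesis using field_le_epsilon[of "\<bar>c - mean f\<bar>" 0] by auto
qed

text \<open>For every \<open>x\<close> some point \<open>x + a\<close> lies in
  \<open>x0 + U\<close>, where \<open>f\<close> is at most \<open>f x0 + e\<close>. This one summand
  lowers the average by its gap to \<open>M\<close> divided by the length.\<close>

lemma oscillation_step:
  assumes "as \<noteq> []" and cover: "\<And>x. \<exists>a\<in>set as. x + a \<in> U"
    and f: "\<And>x. f x \<le> M" and U: "\<And>x t. t \<in> U \<Longrightarrow> f (x + t) \<le> f x + e"
    and M: "f x0 + e \<le> M"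
  shows "avg as f x \<le> M - (M - (f x0 + e)) / real (length as)"
proof -
  obtain a where a: "a \<in> set as" "(x - x0) + a \<in> U" using cover by blast
  then obtain bs cs where as: "as = bs @ a # cs" by (meson split_list)
  have "f (x + a) \<le> f x0 + e" using U[OF a(2), of x0] by (simp add: algebra_simps)
  moreover have "(\<Sum>a\<leftarrow>bs. f (x + a)) \<le> (\<Sum>a\<leftarrow>bs. M)" "(\<Sum>a\<leftarrow>cs. f (x + a)) \<le> (\<Sum>a\<leftarrow>cs. M)"
    by (intro sum_list_mono f)+
  ultimately have "(\<Sum>a\<leftarrow>as. f (x + a)) \<le> M * real (length as) - (M - (f x0 + e))"
    by (simp add: as sum_list_triv algebra_simps)
  then show ?thesis using assms(1) by (simp add: avg_def field_simps)
qed

text \<open>Let \<open>r0\<close> be the infimum of the oscillation bounds reached by averages of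
  \<open>f\<close>. Averaging again lowers a bound above \<open>3 * e\<close> by an amount depending
  on \<open>e\<close> alone, so a positive \<open>r0\<close> would be undercut.\<close>

lemma oscillation_small:
  fixes f :: "'a::topological_ab_group_add \<Rightarrow> real"
  assumes cpt: "compact (UNIV :: 'a set)" and f: "continuous_on UNIV f" and "r > 0"
  shows "\<exists>as. as \<noteq> [] \<and> (\<forall>x y. avg as f x - avg as f y \<le> r)"
proof -
  define Q where "Q r \<longleftrightarrow> (\<exists>as. as \<noteq> [] \<and> (\<forall>x y. avg as f x - avg as f y \<le> r))" for r
  \<comment> \<open>The list \<open>as\<close> is chosen before \<open>bs\<close>: every average of
    \<open>f\<close> inherits the neighbourhood \<open>U\<close> from \<open>f\<close>, so all of
    them gain the same \<open>e / length as\<close>.\<close>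
  have step: "\<exists>d>0. \<forall>r. Q r \<longrightarrow> 3 * e < r \<longrightarrow> Q (r - d)" if "e > 0" for e
  proof -
    obtain U where U: "open U" "0 \<in> U" "\<And>t x. t \<in> U \<Longrightarrow> dist (f (x + t)) (f x) \<le> e"
      using uniform_shift[OF cpt f \<open>e > 0\<close>] by metis
    obtain as where as: "as \<noteq> []" "\<And>x. \<exists>a\<in>set as. x + a \<in> U"
      using finite_translates[OF cpt U(1,2)] by metis
    have "Q (r - e / real (length as))" if r: "Q r" "3 * e < r" for r
    proof -
      obtain bs where bs: "bs \<noteq> []" "\<And>x y. avg bs f x - avg bs f y \<le> r"
        using r by (auto simp: Q_def)
      define g where "g = avg bs f"
      have gU: "g (x + t) \<le> g x + e" if "t \<in> U" for t x
      proof -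
        have "g (x + t) + - g x = avg bs (\<lambda>x. f (x + t) + - f x) x"
          unfolding avg_add g_def avg_uminus by (simp add: avg_def add_ac)
        also have "\<dots> \<le> e"
          by (intro avg_le bs) (use U(3)[OF that] in \<open>simp add: dist_real_def abs_le_iff\<close>)
        finally show ?thesis by simp
      qed
      define m where "m = Inf (range g)"
      have bdd: "bdd_below (range g)"
        by (rule bdd_belowI[of _ "g 0 - r"]) (use bs(2)[of 0] in \<open>auto simp: g_def algebra_simps\<close>)
      have m: "m \<le> g x" for x
        unfolding m_def by (intro cInf_lower bdd) auto
      obtain x0 where x0: "g x0 < m + e"
        using cInf_lessD[of "range g" "m + e"] \<open>e > 0\<close> by (auto simp: m_def)
      have gM: "g x \<le> m + r" for x
      proof -
        have "g x - r \<le> m" unfolding m_def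
          by (rule cInf_greatest) (use bs(2)[of x] in \<open>auto simp: g_def algebra_simps\<close>)
        then show ?thesis by simp
      qed
      \<comment> \<open>Since \<open>g x0 < m + e\<close> and \<open>3 * e < r\<close>, the gap
        \<open>m + r - (g x0 + e)\<close> exceeds \<open>e\<close>.\<close>
      have hi: "avg as g x \<le> m + r - e / real (length as)" for x
      proof -
        have "avg as g x \<le> m + r - (m + r - (g x0 + e)) / real (length as)"
          using r(2) x0 \<open>e > 0\<close> by (intro oscillation_step[OF as] gM gU) auto
        moreover have "e / real (length as) \<le> (m + r - (g x0 + e)) / real (length as)"
          using r(2) x0 by (intro divide_right_mono) auto
        ultimately show ?thesis by linarith
      qed
      have lo: "m \<le> avg as g x" for x by (intro avg_ge as m)
      have "avg as g x - avg as g y \<le> r - e / real (length as)" for x y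
        using hi[of x] lo[of y] by linarith
      moreover have "avg as g = avg (concat (map (\<lambda>a. map ((+) a) bs) as)) f"
        by (simp add: g_def avg_avg fun_eq_iff)
      moreover have "concat (map (\<lambda>a. map ((+) a) bs) as) \<noteq> []"
        using as(1) bs(1) by (cases as; cases bs) auto
      ultimately show ?thesis unfolding Q_def by metis
    qed
    then show ?thesis using as(1) \<open>e > 0\<close> by (intro exI[of _ "e / real (length as)"]) auto
  qed
  define r0 where "r0 = Inf {r. 0 \<le> r \<and> Q r}"
  have mono: "Q r'" if "Q r" "r \<le> r'" for r r'
    using that unfolding Q_def by (meson order_trans)
  obtain B where B: "\<And>x. \<bar>f x\<bar> \<le> B" using continuous_bounded[OF cpt f] by metis
  have "Q (2 * B)"
  proof -
    have "avg [0] f x - avg [0] f y \<le> 2 * B" for x y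
      using B[of x] B[of y] unfolding avg_single add_0_right by linarith
    then show ?thesis unfolding Q_def by (metis list.discI)
  qed
  then have ne: "2 * B \<in> {r. 0 \<le> r \<and> Q r}" using B[of 0] by simp
  have near: "\<exists>r'\<ge>0. Q r' \<and> r' < r" if "r0 < r" for r
    using cInf_lessD[of "{r. 0 \<le> r \<and> Q r}" r] ne that unfolding r0_def by blast
  have "r0 \<le> 0"
  proof (rule ccontr)
    assume "\<not> r0 \<le> 0"
    then obtain d where d: "d > 0" "\<And>r. Q r \<Longrightarrow> 3 * (r0 / 4) < r \<Longrightarrow> Q (r - d)"
      using step[of "r0/4"] by auto
    obtain r where r: "0 \<le> r" "Q r" "r < r0 + min d (r0/4)"
      using near[of "r0 + min d (r0/4)"] d(1) \<open>\<not> r0 \<le> 0\<close> by auto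
    have low: "r0 \<le> r'" if "0 \<le> r'" "Q r'" for r'
      unfolding r0_def using that by (intro cInf_lower) (auto intro: bdd_belowI[of _ 0])
    have "Q (r - d)" using d(2)[OF r(2)] low[OF r(1,2)] \<open>\<not> r0 \<le> 0\<close> by linarith
    \<comment> \<open>The maximum with 0 stays in the set whose infimum is \<open>r0\<close>, yet
      lies below \<open>r0\<close>.\<close>
    then have "Q (max 0 (r - d))" by (rule mono) simp
    then have "r0 \<le> max 0 (r - d)" by (intro low) auto
    then show False using r(3) \<open>\<not> r0 \<le> 0\<close> by (auto simp: max_def split: if_splits)
  qed
  then obtain r' where "0 \<le> r'" "Q r'" "r' < r"
    using near[of r] \<open>r > 0\<close> by auto
  then show ?thesis using mono[of r' r] by (simp add: Q_def)
qed

lemma mean_approx: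
  fixes f :: "'a::topological_ab_group_add \<Rightarrow> real"
  assumes cpt: "compact (UNIV :: 'a set)" and f: "continuous_on UNIV f" and "e > 0"
  obtains as where "as \<noteq> []" "\<And>x. \<bar>avg as f x - mean f\<bar> \<le> e"
proof -
  obtain B where B: "\<And>x. \<bar>f x\<bar> \<le> B" using continuous_bounded[OF cpt f] by metis
  obtain as where "as \<noteq> []" "\<And>x y. avg as f x - avg as f y \<le> e"
    using oscillation_small[OF cpt f \<open>e > 0\<close>] by auto
  with mean_close[OF B this] show ?thesis by (intro that) auto
qed

section \<open>Linearity, invariance and positivity of the mean\<close>

context
  assumes cpt: "compact (UNIV :: 'a::topological_ab_group_add set)"
begin

lemma mean_const [simp]: "mean (\<lambda>x::'a. c) = c"
  by (rule mean_eqI[of _ "\<bar>c\<bar>"]) (auto intro!: exI[of _ "[0]"])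

lemma mean_shift:
  fixes f :: "'a \<Rightarrow> real"
  assumes f: "continuous_on UNIV f"
  shows "mean (\<lambda>x. f (x + a)) = mean f"
proof -
  obtain B where B: "\<And>x. \<bar>f x\<bar> \<le> B" using continuous_bounded[OF cpt f] by metis
  show ?thesis
  proof (rule mean_eqI[of _ B])
    fix e :: real assume "e > 0"
    then obtain as where as: "as \<noteq> []" "\<And>x. \<bar>avg as f x - mean f\<bar> \<le> e"
      using mean_approx[OF cpt f] by metis
    have "avg as (\<lambda>x. f (x + a)) x = avg as f (x + a)" for x
      by (simp add: avg_def add_ac)
    then show "\<exists>as. as \<noteq> [] \<and> (\<forall>x. \<bar>avg as (\<lambda>x. f (x + a)) x - mean f\<bar> \<le> e)"
      using as by metis
  qed (rule B)
qed

lemma mean_add: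
  fixes f g :: "'a \<Rightarrow> real"
  assumes f: "continuous_on UNIV f" and g: "continuous_on UNIV g"
  shows "mean (\<lambda>x. f x + g x) = mean f + mean g"
proof -
  have "continuous_on UNIV (\<lambda>x. f x + g x)" by (intro continuous_intros f g)
  then obtain B where B: "\<And>x. \<bar>f x + g x\<bar> \<le> B" using continuous_bounded[OF cpt] by metis
  show ?thesis
  proof (rule mean_eqI[of _ B])
    fix e :: real assume "e > 0"
    obtain as where as: "as \<noteq> []" "\<And>x. \<bar>avg as f x - mean f\<bar> \<le> e/2"
      using mean_approx[OF cpt f, of "e/2"] \<open>e > 0\<close> by auto
    obtain bs where bs: "bs \<noteq> []" "\<And>x. \<bar>avg bs g x - mean g\<bar> \<le> e/2"
      using mean_approx[OF cpt g, of "e/2"] \<open>e > 0\<close> by auto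
    \<comment> \<open>Averaging a nearly constant function again leaves it nearly constant, so the
      composite list serves \<open>f\<close> and \<open>g\<close> at once.\<close>
    define cs where "cs = concat (map (\<lambda>a. map ((+) a) bs) as)"
    have ne: "cs \<noteq> []" using as(1) bs(1) by (cases as; cases bs) (auto simp: cs_def)
    have "\<bar>avg cs (\<lambda>x. f x + g x) x - (mean f + mean g)\<bar> \<le> e" for x
    proof -
      have eq: "avg cs (\<lambda>x. f x + g x) x = avg bs (avg as f) x + avg as (avg bs g) x"
        by (simp add: cs_def avg_add flip: avg_avg avg_commute[of as bs])
      have "mean f - e/2 \<le> avg as f x" "avg as f x \<le> mean f + e/2"
        "mean g - e/2 \<le> avg bs g x" "avg bs g x \<le> mean g + e/2" for x
        using as(2)[of x] bs(2)[of x] by linarith+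
      then have "mean f - e/2 \<le> avg bs (avg as f) x" "avg bs (avg as f) x \<le> mean f + e/2"
        "mean g - e/2 \<le> avg as (avg bs g) x" "avg as (avg bs g) x \<le> mean g + e/2"
        by (blast intro: avg_ge[OF bs(1)] avg_le[OF bs(1)] avg_ge[OF as(1)] avg_le[OF as(1)])+
      then show ?thesis unfolding eq by linarith
    qed
    then show "\<exists>as. as \<noteq> [] \<and> (\<forall>x. \<bar>avg as (\<lambda>x. f x + g x) x - (mean f + mean g)\<bar> \<le> e)"
      using ne by metis
  qed (rule B)
qed

lemma mean_scale:
  fixes f :: "'a \<Rightarrow> real"
  assumes f: "continuous_on UNIV f"
  shows "mean (\<lambda>x. c * f x) = c * mean f"
proof -
  have "continuous_on UNIV (\<lambda>x. c * f x)" by (intro continuous_intros f)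
  then obtain B where B: "\<And>x. \<bar>c * f x\<bar> \<le> B" using continuous_bounded[OF cpt] by metis
  show ?thesis
  proof (rule mean_eqI[of _ B])
    fix e :: real assume "e > 0"
    obtain as where as: "as \<noteq> []" "\<And>x. \<bar>avg as f x - mean f\<bar> \<le> e / (\<bar>c\<bar> + 1)"
      using mean_approx[OF cpt f, of "e / (\<bar>c\<bar> + 1)"] \<open>e > 0\<close> by auto
    have "\<bar>avg as (\<lambda>x. c * f x) x - c * mean f\<bar> \<le> e" for x
    proof -
      have "\<bar>avg as (\<lambda>x. c * f x) x - c * mean f\<bar> = \<bar>c\<bar> * \<bar>avg as f x - mean f\<bar>"
        by (simp add: avg_scale abs_mult flip: right_diff_distrib)
      also have "\<dots> \<le> (\<bar>c\<bar> + 1) * (e / (\<bar>c\<bar> + 1))"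
        using as(2) by (intro mult_mono) auto
      finally show ?thesis by simp
    qed
    then show "\<exists>as. as \<noteq> [] \<and> (\<forall>x. \<bar>avg as (\<lambda>x. c * f x) x - c * mean f\<bar> \<le> e)"
      using as by metis
  qed (rule B)
qed

lemma mean_uminus:
  fixes f :: "'a \<Rightarrow> real"
  assumes "continuous_on UNIV f"
  shows "mean (\<lambda>x. - f x) = - mean f"
  using mean_scale[OF assms, of "-1"] by simp

lemma mean_diff:
  fixes f g :: "'a \<Rightarrow> real"
  assumes "continuous_on UNIV f" "continuous_on UNIV g"
  shows "mean (\<lambda>x. f x - g x) = mean f - mean g"
  using mean_add[OF assms(1), of "\<lambda>x. - g x"] assms by (simp add: mean_uminus continuous_on_minus)

lemma mean_ge:
  fixes f :: "'a \<Rightarrow> real"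
  assumes f: "continuous_on UNIV f" and c: "\<And>x. c \<le> f x"
  shows "c \<le> mean f"
proof (rule field_le_epsilon)
  fix e :: real assume "e > 0"
  then obtain as where as: "as \<noteq> []" "\<And>x. \<bar>avg as f x - mean f\<bar> \<le> e"
    using mean_approx[OF cpt f] by metis
  have "c \<le> avg as f 0" by (intro avg_ge as c)
  then show "c \<le> mean f + e" using as(2)[of 0] by linarith
qed

lemma mean_mono:
  fixes f g :: "'a \<Rightarrow> real"
  assumes "continuous_on UNIV f" "continuous_on UNIV g" "\<And>x. f x \<le> g x"
  shows "mean f \<le> mean g"
  using mean_ge[of "\<lambda>x. g x - f x" 0] assms by (simp add: mean_diff continuous_on_diff)

lemma mean_le:
  fixes f :: "'a \<Rightarrow> real"
  assumes "continuous_on UNIV f" "\<And>x. f x \<le> c"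
  shows "mean f \<le> c"
  using mean_mono[OF assms(1) continuous_on_const assms(2)] by simp

text \<open>Finitely many translates of the set where \<open>f\<close> exceeds
  \<open>f x0 / 2\<close> cover the group, so one fixed list gives an average bounded below by a
  positive constant.\<close>

lemma mean_pos:
  fixes f :: "'a \<Rightarrow> real"
  assumes f: "continuous_on UNIV f" and nn: "\<And>x. 0 \<le> f x" and pos: "0 < f x0"
  shows "0 < mean f"
proof -
  define U where "U = f -` {f x0 / 2<..}"
  have "open U" unfolding U_def by (rule open_vimage[OF open_greaterThan f])
  moreover have "x0 \<in> U" using pos by (simp add: U_def)
  ultimately obtain as where as: "as \<noteq> []" "\<And>x. \<exists>a\<in>set as. x + a \<in> U"
    using finite_translates[OF cpt] by metis
  have "f x0 / 2 / real (length as) \<le> avg as f x" for x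
  proof -
    obtain a where a: "a \<in> set as" "x + a \<in> U" using as(2) by blast
    have "f (x + a) \<le> (\<Sum>a\<leftarrow>as. f (x + a))"
      using member_le_sum_list[of "f (x + a)" "map (\<lambda>a. f (x + a)) as"] a(1) nn by auto
    then show ?thesis using a(2) as(1) by (auto simp: avg_def U_def field_simps)
  qed
  moreover obtain B where B: "\<And>x. \<bar>f x\<bar> \<le> B" using continuous_bounded[OF cpt f] by metis
  moreover have "bdd_above {m. \<exists>as. as \<noteq> [] \<and> (\<forall>x. m \<le> avg as f x)}"
  proof (intro bdd_aboveI[of _ B], clarify)
    fix m as assume "as \<noteq> []" "\<forall>x. m \<le> avg as f x"
    moreover have "avg as f 0 \<le> B" if "as \<noteq> []" for as
      using that B by (intro avg_le) (auto intro: abs_le_D1)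
    ultimately show "m \<le> B" by (meson order_trans)
  qed
  ultimately have "f x0 / 2 / real (length as) \<le> mean f"
    unfolding mean_def using as(1) by (intro cSup_upper) auto
  moreover have "0 < f x0 / 2 / real (length as)" using pos as(1) by simp
  ultimately show ?thesis by linarith
qed

end

section \<open>Characters separate points\<close>

definition cmean :: "('a::ab_group_add \<Rightarrow> complex) \<Rightarrow> complex" where
  "cmean f = Complex (mean (\<lambda>x. Re (f x))) (mean (\<lambda>x. Im (f x)))"

lemma Re_cmean [simp]: "Re (cmean f) = mean (\<lambda>x. Re (f x))"
  and Im_cmean [simp]: "Im (cmean f) = mean (\<lambda>x. Im (f x))"
  by (simp_all add: cmean_def)

text \<open>The convolution of \<open>u\<close> with its conjugate reflection: a positive definite
  function whose value at 0 is the mean square of \<open>u\<close>.\<close>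

definition autocorr :: "('a::ab_group_add \<Rightarrow> complex) \<Rightarrow> 'a \<Rightarrow> complex" where
  "autocorr u x = cmean (\<lambda>t. u (t + x) * cnj (u t))"

text \<open>A character \<open>h\<close> has energy \<open>(cmod (h g - 1))\<^sup>2\<close>, so
  positive energy detects that it is nontrivial at \<open>g\<close>.\<close>

definition energy :: "'a::ab_group_add \<Rightarrow> ('a \<Rightarrow> complex) \<Rightarrow> real" where
  "energy g h = mean (\<lambda>x. (cmod (h (x + g) - h x))\<^sup>2)"

definition sup_energy :: "'a::topological_ab_group_add \<Rightarrow> real" where
  "sup_energy g = Sup {energy g (autocorr u) | u. continuous_on UNIV u \<and> autocorr u 0 = 1}"

lemma parallelogram_ineq: "(cmod (a + b))\<^sup>2 \<le> 2 * (cmod a)\<^sup>2 + 2 * (cmod b)\<^sup>2"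
proof -
  have "0 \<le> (Re a - Re b)\<^sup>2 + (Im a - Im b)\<^sup>2" by simp
  then show ?thesis unfolding cmod_power2 by (simp add: power2_eq_square algebra_simps)
qed

section \<open>Complex means and autocorrelations\<close>

context
  assumes cpt: "compact (UNIV :: 'a::topological_ab_group_add set)"
begin

lemma continuous_shift:
  fixes f :: "'a \<Rightarrow> 'b::topological_space"
  assumes "continuous_on UNIV f"
  shows "continuous_on UNIV (\<lambda>x. f (x + a))"
  by (rule continuous_on_compose2[OF assms]) (auto intro!: continuous_intros)

lemma mean_lin2:
  fixes f g :: "'a \<Rightarrow> real"
  assumes "continuous_on UNIV f" "continuous_on UNIV g"
  shows "mean (\<lambda>x. a * f x + b * g x) = a * mean f + b * mean g"
  using assms by (simp add: mean_add[OF cpt] mean_scale[OF cpt] continuous_intros)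

lemma mean_lin3:
  fixes f g h :: "'a \<Rightarrow> real"
  assumes "continuous_on UNIV f" "continuous_on UNIV g" "continuous_on UNIV h"
  shows "mean (\<lambda>x. a * f x + b * g x + c * h x) = a * mean f + b * mean g + c * mean h"
  using assms by (simp add: mean_add[OF cpt] mean_scale[OF cpt] continuous_intros)

lemma cmean_add:
  fixes f g :: "'a \<Rightarrow> complex"
  assumes "continuous_on UNIV f" "continuous_on UNIV g"
  shows "cmean (\<lambda>x. f x + g x) = cmean f + cmean g"
  using assms by (simp add: complex_eq_iff mean_add[OF cpt] continuous_intros)

lemma cmean_diff:
  fixes f g :: "'a \<Rightarrow> complex"
  assumes "continuous_on UNIV f" "continuous_on UNIV g"
  shows "cmean (\<lambda>x. f x - g x) = cmean f - cmean g"
  using assms by (simp add: complex_eq_iff mean_diff[OF cpt] continuous_intros)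

lemma cmean_scale:
  fixes f :: "'a \<Rightarrow> complex"
  assumes "continuous_on UNIV f"
  shows "cmean (\<lambda>x. c * f x) = c * cmean f"
  using assms
  by (simp add: complex_eq_iff mean_add[OF cpt] mean_diff[OF cpt] mean_scale[OF cpt] continuous_intros)

lemma cmean_shift:
  fixes f :: "'a \<Rightarrow> complex"
  assumes "continuous_on UNIV f"
  shows "cmean (\<lambda>x. f (x + a)) = cmean f"
proof -
  have "continuous_on UNIV (\<lambda>x. Re (f x))" "continuous_on UNIV (\<lambda>x. Im (f x))"
    by (intro continuous_intros assms)+
  then show ?thesis
    using mean_shift[OF cpt, of "\<lambda>x. Re (f x)"] mean_shift[OF cpt, of "\<lambda>x. Im (f x)"]
    by (simp add: complex_eq_iff)
qed

lemma cmean_const [simp]: "cmean (\<lambda>x::'a. c) = c"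
  by (simp add: complex_eq_iff mean_const[OF cpt])

lemma cmean_cnj:
  fixes f :: "'a \<Rightarrow> complex"
  assumes "continuous_on UNIV f"
  shows "cmean (\<lambda>x. cnj (f x)) = cnj (cmean f)"
  using assms by (simp add: complex_eq_iff mean_uminus[OF cpt] continuous_on_Im)

text \<open>The factor 2 comes from bounding the real and imaginary parts separately.\<close>

lemma norm_cmean_le:
  fixes f :: "'a \<Rightarrow> complex"
  assumes f: "continuous_on UNIV f" and B: "\<And>x. cmod (f x) \<le> B"
  shows "cmod (cmean f) \<le> 2 * B"
proof -
  have Re: "\<bar>Re (f x)\<bar> \<le> B" and Im: "\<bar>Im (f x)\<bar> \<le> B" for x
    using abs_Re_le_cmod[of "f x"] abs_Im_le_cmod[of "f x"] B[of x] by linarith+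
  have "- B \<le> Re (f x)" "Re (f x) \<le> B" "- B \<le> Im (f x)" "Im (f x) \<le> B" for x
    using Re[of x] Im[of x] by linarith+
  moreover have "continuous_on UNIV (\<lambda>x. Re (f x))" "continuous_on UNIV (\<lambda>x. Im (f x))"
    by (intro continuous_intros f)+
  ultimately have "\<bar>Re (cmean f)\<bar> \<le> B" "\<bar>Im (cmean f)\<bar> \<le> B"
    by (auto simp: abs_le_iff minus_le_iff intro!: mean_ge[OF cpt] mean_le[OF cpt])
  then show ?thesis using cmod_le[of "cmean f"] by linarith
qed

lemma continuous_cmean:
  fixes F :: "'b::topological_space \<Rightarrow> 'a \<Rightarrow> complex"
  assumes F: "continuous_on UNIV (\<lambda>p. F (fst p) (snd p))"
  shows "continuous_on UNIV (\<lambda>x. cmean (F x))"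
  unfolding continuous_on_def
proof (intro ballI tendstoI)
  fix x0 :: 'b and e :: real assume e: "e > 0"
  have cont: "continuous_on UNIV (F x)" for x
    using continuous_on_compose2[OF F, of UNIV "\<lambda>t. (x, t)"] by (simp add: continuous_intros)
  have "continuous_on (UNIV \<times> UNIV) (\<lambda>p. F (fst p) (snd p))" using F by simp
  \<comment> \<open>The bound \<open>e / 3\<close> leaves room for the factor 2 in
    \<open>norm_cmean_le\<close>.\<close>
  then obtain X where X: "x0 \<in> X" "open X" "\<forall>x\<in>X \<inter> UNIV. \<forall>t\<in>UNIV.
      dist (F (fst (x, t)) (snd (x, t))) (F (fst (x0, t)) (snd (x0, t))) \<le> e / 3"
    by (rule continuous_on_prod_compactE[OF _ cpt UNIV_I, of _ "e/3"]) (use e in auto)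
  have "dist (cmean (F x)) (cmean (F x0)) < e" if "x \<in> X" for x
  proof -
    have "cmod (cmean (\<lambda>t. F x t - F x0 t)) \<le> 2 * (e / 3)"
      using X(3) that by (intro norm_cmean_le continuous_intros cont) (auto simp: dist_norm)
    then show ?thesis using e by (simp add: cmean_diff cont dist_norm)
  qed
  then show "\<forall>\<^sub>F x in at x0 within UNIV. dist (cmean (F x)) (cmean (F x0)) < e"
    unfolding eventually_at_topological using X by blast
qed

lemma continuous_autocorr:
  fixes u :: "'a \<Rightarrow> complex"
  assumes u: "continuous_on UNIV u"
  shows "continuous_on UNIV (autocorr u)"
  unfolding autocorr_def
  by (intro continuous_cmean continuous_intros continuous_on_compose2[OF u]) auto

lemma autocorr_zero:
  "autocorr u (0::'a) = complex_of_real (mean (\<lambda>t. (cmod (u t))\<^sup>2))"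
  by (simp add: autocorr_def complex_eq_iff cmod_power2 mean_const[OF cpt] mult.commute flip: power2_eq_square)

text \<open>Cauchy-Schwarz in the form of \<open>2 * p * q \<le> p^2 + q^2\<close> under the mean:
  by shift invariance, \<open>u\<close> and its translate have the same mean square.\<close>

lemma Re_autocorr_le:
  fixes u :: "'a \<Rightarrow> complex"
  assumes u: "continuous_on UNIV u" and a: "cmod a = 1"
  shows "Re (a * autocorr u y) \<le> Re (autocorr u 0)"
proof -
  have uy: "continuous_on UNIV (\<lambda>t. u (t + y))" by (rule continuous_shift[OF u])
  have "Re (a * (u (t + y) * cnj (u t))) \<le> (1/2) * (cmod (u (t + y)))\<^sup>2 + (1/2) * (cmod (u t))\<^sup>2" for t
  proof -
    have "Re (a * (u (t + y) * cnj (u t))) \<le> cmod (u (t + y)) * cmod (u t)"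
      using complex_Re_le_cmod[of "a * (u (t + y) * cnj (u t))"] a by (simp add: norm_mult)
    also have "\<dots> \<le> (1/2) * (cmod (u (t + y)))\<^sup>2 + (1/2) * (cmod (u t))\<^sup>2"
      using sum_squares_bound[of "cmod (u (t + y))" "cmod (u t)"] by simp
    finally show ?thesis .
  qed
  then have "mean (\<lambda>t. Re (a * (u (t + y) * cnj (u t))))
      \<le> mean (\<lambda>t. (1/2) * (cmod (u (t + y)))\<^sup>2 + (1/2) * (cmod (u t))\<^sup>2)"
    by (intro mean_mono[OF cpt] continuous_intros u uy)
  also have "\<dots> = (1/2) * mean (\<lambda>t. (cmod (u (t + y)))\<^sup>2) + (1/2) * mean (\<lambda>t. (cmod (u t))\<^sup>2)"
    by (intro mean_lin2 continuous_intros u uy)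
  also have "mean (\<lambda>t. (cmod (u (t + y)))\<^sup>2) = mean (\<lambda>t. (cmod (u t))\<^sup>2)"
    by (intro mean_shift[OF cpt, of "\<lambda>t. (cmod (u t))\<^sup>2"] continuous_intros u)
  also have "mean (\<lambda>t. Re (a * (u (t + y) * cnj (u t)))) = Re (a * autocorr u y)"
    unfolding autocorr_def by (subst cmean_scale[symmetric]) (auto intro!: continuous_intros u uy)
  finally show ?thesis by (simp add: autocorr_zero)
qed

text \<open>Expanding gives four shifted products; because \<open>a * cnj a = 1\<close>, both
  diagonal ones contribute \<open>autocorr u x\<close>.\<close>

lemma autocorr_combination:
  fixes u :: "'a \<Rightarrow> complex"
  assumes u: "continuous_on UNIV u" and a: "cmod a = 1"
  shows "autocorr (\<lambda>t. u t + a * u (t + y)) x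
    = 2 * autocorr u x + (a * autocorr u (x + y) + cnj a * autocorr u (x - y))"
proof -
  have c: "continuous_on UNIV (\<lambda>t. u (t + z) * cnj (u (t + w)))" for z w
    by (intro continuous_intros continuous_shift u)
  have sh: "cmean (\<lambda>t. u (t + z) * cnj (u (t + w))) = autocorr u (z - w)" for z w
    using cmean_shift[OF c[of "z - w" 0], of w] by (simp add: autocorr_def algebra_simps)
  have "a * cnj a = 1" using a complex_norm_square[of a] by simp
  then have "(u (t + x) + a * u (t + x + y)) * cnj (u t + a * u (t + y))
      = u (t + x) * cnj (u (t + 0)) + u (t + (x + y)) * cnj (u (t + y))
        + (a * (u (t + (x + y)) * cnj (u (t + 0))) + cnj a * (u (t + x) * cnj (u (t + y))))" for t
    by (simp add: algebra_simps)
  then have "autocorr (\<lambda>t. u t + a * u (t + y)) x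
     = cmean (\<lambda>t. u (t + x) * cnj (u (t + 0))) + cmean (\<lambda>t. u (t + (x + y)) * cnj (u (t + y)))
       + (a * cmean (\<lambda>t. u (t + (x + y)) * cnj (u (t + 0))) + cnj a * cmean (\<lambda>t. u (t + x) * cnj (u (t + y))))"
    unfolding autocorr_def by (simp only: cmean_add cmean_scale c continuous_intros)
  then show ?thesis unfolding sh by simp
qed

lemma autocorr_minus:
  fixes u :: "'a \<Rightarrow> complex"
  assumes u: "continuous_on UNIV u"
  shows "autocorr u (- y) = cnj (autocorr u y)"
proof -
  have c: "continuous_on UNIV (\<lambda>t. u (t + z) * cnj (u (t + w)))" for z w
    by (intro continuous_intros continuous_shift u)
  have "autocorr u (- y) = cmean (\<lambda>t. u (t + 0) * cnj (u (t + y)))"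
    using cmean_shift[OF c[of "- y" 0], of y] by (simp add: autocorr_def)
  also have "\<dots> = cmean (\<lambda>t. cnj (u (t + y) * cnj (u (t + 0))))" by (simp add: mult.commute)
  also have "\<dots> = cnj (cmean (\<lambda>t. u (t + y) * cnj (u (t + 0))))"
    by (rule cmean_cnj[OF c])
  finally show ?thesis by (simp add: autocorr_def)
qed

section \<open>The energy functional and its supremum\<close>

lemma continuous_energy:
  fixes h :: "'a \<Rightarrow> complex"
  assumes h: "continuous_on UNIV h"
  shows "continuous_on UNIV (\<lambda>x. (cmod (h (x + g) - h x))\<^sup>2)"
  by (intro continuous_intros continuous_shift h)

lemma energy_nonneg:
  fixes h :: "'a \<Rightarrow> complex"
  assumes h: "continuous_on UNIV h"
  shows "0 \<le> energy g h"
  unfolding energy_def by (intro mean_ge[OF cpt] continuous_energy h) auto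

lemma energy_scale:
  fixes h :: "'a \<Rightarrow> complex"
  assumes h: "continuous_on UNIV h"
  shows "energy g (\<lambda>x. c * h x) = (cmod c)\<^sup>2 * energy g h"
  unfolding energy_def
  by (subst mean_scale[OF cpt continuous_energy[OF h], symmetric])
     (simp add: norm_mult power_mult_distrib flip: right_diff_distrib)

lemma energy_shift:
  fixes h :: "'a \<Rightarrow> complex"
  assumes h: "continuous_on UNIV h"
  shows "energy g (\<lambda>x. h (x + a)) = energy g h"
  using mean_shift[OF cpt continuous_energy[OF h, of g], of a] by (simp add: energy_def add_ac)

lemma energy_add_le:
  fixes h k :: "'a \<Rightarrow> complex"
  assumes h: "continuous_on UNIV h" and k: "continuous_on UNIV k"
  shows "energy g (\<lambda>x. h x + k x) \<le> 2 * energy g h + 2 * energy g k"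
proof -
  have "energy g (\<lambda>x. h x + k x)
      \<le> mean (\<lambda>x. 2 * (cmod (h (x + g) - h x))\<^sup>2 + 2 * (cmod (k (x + g) - k x))\<^sup>2)"
    unfolding energy_def
  proof (intro mean_mono[OF cpt])
    show "(cmod (h (x + g) + k (x + g) - (h x + k x)))\<^sup>2
        \<le> 2 * (cmod (h (x + g) - h x))\<^sup>2 + 2 * (cmod (k (x + g) - k x))\<^sup>2" for x
      using parallelogram_ineq[of "h (x + g) - h x" "k (x + g) - k x"] by (simp add: algebra_simps)
  qed (intro continuous_intros continuous_shift h k)+
  also have "\<dots> = 2 * energy g h + 2 * energy g k"
    unfolding energy_def
    by (intro mean_lin2 continuous_energy h k)
  finally show ?thesis .
qed

lemma energy_parallelogram:
  fixes h D :: "'a \<Rightarrow> complex" and r :: real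
  assumes h: "continuous_on UNIV h" and D: "continuous_on UNIV D"
  shows "energy g (\<lambda>x. D x - 2 * of_real r * h x)
    = (1 - r) / 2 * energy g (\<lambda>x. 2 * h x + D x) + (1 + r) / 2 * energy g (\<lambda>x. 2 * h x - D x)
      + (- 4 * (1 - r\<^sup>2)) * energy g h"
proof -
  \<comment> \<open>The weights are those for which the cross terms of \<open>d\<close> and
    \<open>e\<close> agree on both sides; what remains is a multiple of
    \<open>(cmod d)\<^sup>2\<close>.\<close>
  have pt: "(cmod (e - 2 * of_real r * d))\<^sup>2
    = (1 - r) / 2 * (cmod (2 * d + e))\<^sup>2 + (1 + r) / 2 * (cmod (2 * d - e))\<^sup>2
      + (- 4 * (1 - r\<^sup>2)) * (cmod d)\<^sup>2" for d e
    unfolding cmod_power2 by (simp add: field_simps power2_eq_square)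
  have "energy g (\<lambda>x. D x - 2 * of_real r * h x)
    = mean (\<lambda>x. (1 - r) / 2 * (cmod (2 * h (x + g) + D (x + g) - (2 * h x + D x)))\<^sup>2
         + (1 + r) / 2 * (cmod (2 * h (x + g) - D (x + g) - (2 * h x - D x)))\<^sup>2
         + (- 4 * (1 - r\<^sup>2)) * (cmod (h (x + g) - h x))\<^sup>2)"
    unfolding energy_def
  proof (rule arg_cong[where f = mean], rule ext)
    fix x show "(cmod (D (x + g) - 2 * of_real r * h (x + g) - (D x - 2 * of_real r * h x)))\<^sup>2
      = (1 - r) / 2 * (cmod (2 * h (x + g) + D (x + g) - (2 * h x + D x)))\<^sup>2
         + (1 + r) / 2 * (cmod (2 * h (x + g) - D (x + g) - (2 * h x - D x)))\<^sup>2
         + (- 4 * (1 - r\<^sup>2)) * (cmod (h (x + g) - h x))\<^sup>2"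
      using pt[of "D (x + g) - D x" "h (x + g) - h x"] by (simp add: algebra_simps)
  qed
  also have "\<dots> = (1 - r) / 2 * energy g (\<lambda>x. 2 * h x + D x) + (1 + r) / 2 * energy g (\<lambda>x. 2 * h x - D x)
      + (- 4 * (1 - r\<^sup>2)) * energy g h"
    unfolding energy_def by (intro mean_lin3 continuous_energy continuous_intros h D)
  finally show ?thesis .
qed

text \<open>\<open>Re_autocorr_le\<close> at \<open>a = 1, -1, \<i>, -\<i>\<close> bounds the real
  and imaginary parts separately, hence the factor 2.\<close>

lemma norm_autocorr_le:
  fixes u :: "'a \<Rightarrow> complex"
  assumes u: "continuous_on UNIV u"
  shows "(cmod (autocorr u y))\<^sup>2 \<le> 2 * (Re (autocorr u 0))\<^sup>2"
proof -
  have "\<bar>Re (autocorr u y)\<bar> \<le> Re (autocorr u 0)" "\<bar>Im (autocorr u y)\<bar> \<le> Re (autocorr u 0)"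
    using Re_autocorr_le[OF u, of 1 y] Re_autocorr_le[OF u, of "-1" y]
      Re_autocorr_le[OF u, of "\<i>" y] Re_autocorr_le[OF u, of "-\<i>" y] by auto
  then have "(Re (autocorr u y))\<^sup>2 \<le> (Re (autocorr u 0))\<^sup>2" "(Im (autocorr u y))\<^sup>2 \<le> (Re (autocorr u 0))\<^sup>2"
    by (auto simp: abs_le_square_iff[symmetric])
  then show ?thesis by (simp add: cmod_power2)
qed

lemma energy_le_sup:
  fixes u :: "'a \<Rightarrow> complex"
  assumes u: "continuous_on UNIV u" and u1: "autocorr u 0 = 1"
  shows "energy g (autocorr u) \<le> sup_energy g"
  unfolding sup_energy_def
proof (rule cSup_upper)
  show "bdd_above {energy g (autocorr u) |u. continuous_on UNIV u \<and> autocorr u 0 = 1}"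
  \<comment> \<open>The bound is \<open>8 = 2 * 2 + 2 * 2\<close>, since squared moduli of
    normalized autocorrelations are at most 2.\<close>
  proof (rule bdd_aboveI[of _ 8], clarify)
    fix v :: "'a \<Rightarrow> complex" assume v: "continuous_on UNIV v" "autocorr v 0 = 1"
    have "(cmod (autocorr v (x + g) - autocorr v x))\<^sup>2 \<le> 8" for x
      using parallelogram_ineq[of "autocorr v (x + g)" "- autocorr v x"]
        norm_autocorr_le[OF v(1), of "x + g"] norm_autocorr_le[OF v(1), of x] v(2) by simp
    then show "energy g (autocorr v) \<le> 8"
      unfolding energy_def by (intro mean_le[OF cpt] continuous_energy continuous_autocorr v(1))
  qed
qed (use u u1 in blast)

text \<open>Both sides scale with the fourth power of \<open>u\<close>, so dividing \<open>u\<close>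
  by the square root of \<open>autocorr u 0\<close> reduces to the normalized case. If that value is
  0, the autocorrelation vanishes.\<close>

lemma energy_le_sup_scaled:
  fixes u :: "'a \<Rightarrow> complex"
  assumes u: "continuous_on UNIV u"
  shows "energy g (autocorr u) \<le> sup_energy g * (Re (autocorr u 0))\<^sup>2"
proof -
  define c where "c = Re (autocorr u 0)"
  have u0: "autocorr u 0 = of_real c" by (simp add: c_def autocorr_zero)
  have "0 \<le> c" unfolding c_def autocorr_zero
    by (simp, intro mean_ge[OF cpt] continuous_intros u) auto
  show ?thesis
  proof (cases "c = 0")
    case True
    then have "autocorr u = (\<lambda>x. 0)"
      using norm_autocorr_le[OF u] by (auto simp: c_def fun_eq_iff)
    then show ?thesis by (simp add: energy_def mean_const[OF cpt])
  next
    case False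
    then have "c > 0" using \<open>0 \<le> c\<close> by simp
    define d where "d = complex_of_real (1 / sqrt c)"
    have cu: "continuous_on UNIV (\<lambda>t. u (t + x) * cnj (u t))" for x
      by (intro continuous_intros continuous_shift u)
    have dd: "d * cnj d = of_real (1 / c)"
    proof -
      have "1 / sqrt c * (1 / sqrt c) = 1 / c" using \<open>c > 0\<close> by simp
      then show ?thesis unfolding d_def complex_cnj_complex_of_real of_real_mult[symmetric] by (rule arg_cong)
    qed
    have "d * u (t + x) * cnj (d * u t) = of_real (1/c) * (u (t + x) * cnj (u t))" for t x
      unfolding dd[symmetric] by simp
    then have sc: "autocorr (\<lambda>t. d * u t) = (\<lambda>x. of_real (1/c) * autocorr u x)"
      unfolding autocorr_def fun_eq_iff by (simp only: cmean_scale[OF cu] simp_thms)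
    have "energy g (\<lambda>x. of_real (1/c) * autocorr u x) \<le> sup_energy g"
      unfolding sc[symmetric]
    proof (rule energy_le_sup)
      show "autocorr (\<lambda>t. d * u t) 0 = 1" using \<open>c > 0\<close> by (simp add: sc u0)
    qed (intro continuous_intros u)
    also have "energy g (\<lambda>x. of_real (1/c) * autocorr u x) = (cmod (of_real (1/c)))\<^sup>2 * energy g (autocorr u)"
      by (rule energy_scale[OF continuous_autocorr[OF u]])
    finally show ?thesis using \<open>c > 0\<close>
      by (simp add: c_def[symmetric] field_simps power2_eq_square norm_divide)
  qed
qed

text \<open>With \<open>r = Re (a h(y))\<close>, the autocorrelations of \<open>u \<plusminus> a u(\<sqdot> + y)\<close> are \<open>2 h \<plusminus> D\<close> and have value
  \<open>2 (1 \<plusminus> r)\<close> at \<open>0\<close>; bound the energy of both by the supremum and combine by the parallelogram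
  identity.\<close>

lemma near_optimal_symmetric:
  fixes u :: "'a \<Rightarrow> complex" and y :: 'a
  assumes u: "continuous_on UNIV u" and u1: "autocorr u 0 = 1" and a: "cmod a = 1"
  defines "h \<equiv> autocorr u" and "r \<equiv> Re (a * autocorr u y)"
  shows "energy g (\<lambda>x. (a * h (x + y) + cnj a * h (x - y)) - 2 * of_real r * h x)
    \<le> 4 * (sup_energy g - energy g h)"
proof -
  define D where "D x = a * h (x + y) + cnj a * h (x - y)" for x
  define s where "s = sup_energy g"
  have h: "continuous_on UNIV h" unfolding h_def by (rule continuous_autocorr[OF u])
  have D: "continuous_on UNIV D"
    unfolding D_def using continuous_shift[OF h, of "- y"] by (intro continuous_intros continuous_shift h) simp
  have hm: "h (- y) = cnj (h y)"
    unfolding h_def autocorr_minus[OF u] by simp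
  have ac: "autocorr (\<lambda>t. u t + b * u (t + y)) x = 2 * h x + (b * h (x + y) + cnj b * h (x - y))"
    if "cmod b = 1" for b x
    unfolding h_def by (rule autocorr_combination[OF u that])
  have re0: "Re (2 * h 0 + (b * h (0 + y) + cnj b * h (0 - y))) = 2 + 2 * Re (b * h y)" for b
    using u1 hm by (simp add: h_def)
  have le: "energy g (\<lambda>x. 2 * h x + (b * h (x + y) + cnj b * h (x - y))) \<le> s * (2 + 2 * Re (b * h y))\<^sup>2"
    if b: "cmod b = 1" for b
  proof -
    have "continuous_on UNIV (\<lambda>t. u t + b * u (t + y))"
      by (intro continuous_intros continuous_shift u)
    from energy_le_sup_scaled[OF this, of g] show ?thesis
      unfolding ac[OF b] re0 s_def[symmetric] by (simp add: ac[OF b, abs_def])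
  qed
  have plus: "energy g (\<lambda>x. 2 * h x + D x) \<le> s * (2 + 2 * r)\<^sup>2"
    using le[OF a] by (simp add: D_def r_def h_def)
  have minus: "energy g (\<lambda>x. 2 * h x - D x) \<le> s * (2 - 2 * r)\<^sup>2"
    using le[of "- a"] a by (simp add: D_def r_def h_def algebra_simps)
  have r: "\<bar>r\<bar> \<le> 1"
    using Re_autocorr_le[OF u a, of y] Re_autocorr_le[OF u, of "- a" y] a u1 by (simp add: r_def)
  then have r2: "0 \<le> 1 - r\<^sup>2" "1 - r\<^sup>2 \<le> 1" by (simp_all add: abs_square_le_1)
  have gap: "0 \<le> s - energy g h" unfolding s_def h_def using energy_le_sup[OF u u1] by simp
  have "energy g (\<lambda>x. D x - 2 * of_real r * h x)
     \<le> (1 - r) / 2 * (s * (2 + 2 * r)\<^sup>2) + (1 + r) / 2 * (s * (2 - 2 * r)\<^sup>2) + (- 4 * (1 - r\<^sup>2)) * energy g h"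
    unfolding energy_parallelogram[OF h D] using r
    by (intro add_mono mult_left_mono plus minus order_refl) auto
  \<comment> \<open>The same weights fit the bounds at 0: \<open>(1 - r) * (1 + r)\<^sup>2 + (1 + r)
    * (1 - r)\<^sup>2 = 2 * (1 - r\<^sup>2)\<close>.\<close>
  also have "\<dots> = (1 - r\<^sup>2) * (4 * (s - energy g h))"
    by (simp add: field_simps power2_eq_square)
  also have "\<dots> \<le> 1 * (4 * (s - energy g h))"
    using r2 gap by (intro mult_right_mono) auto
  finally show ?thesis by (simp add: D_def s_def)
qed

end

section \<open>From near-maximizers to characters\<close>

definition circle_char :: "('a::topological_ab_group_add \<Rightarrow> complex) \<Rightarrow> bool" where
  "circle_char \<psi> \<longleftrightarrow> continuous_on UNIV \<psi> \<and> (\<forall>x y. \<psi> (x + y) = \<psi> x * \<psi> y) \<and> (\<forall>x. cmod (\<psi> x) = 1)"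

context
  assumes cpt: "compact (UNIV :: 'a::topological_ab_group_add set)"
begin

text \<open>The instances \<open>a = 1\<close> and \<open>a = -\<i>\<close> of
  \<open>near_optimal_symmetric\<close> combine so that the terms in \<open>h (x - y)\<close> cancel
  and the real and imaginary parts of \<open>h y\<close> reassemble.\<close>

lemma near_optimal:
  fixes u :: "'a \<Rightarrow> complex"
  assumes u: "continuous_on UNIV u" and u1: "autocorr u 0 = 1"
  defines "h \<equiv> autocorr u"
  shows "energy g (\<lambda>x. h (x + y) - h y * h x) \<le> 4 * (sup_energy g - energy g h)"
proof -
  define A where "A a x = (a * h (x + y) + cnj a * h (x - y)) - 2 * of_real (Re (a * h y)) * h x" for a x
  have h: "continuous_on UNIV h" unfolding h_def by (rule continuous_autocorr[OF cpt u])
  have A: "continuous_on UNIV (A a)" for a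
    unfolding A_def using continuous_shift[OF cpt h, of "- y"]
    by (intro continuous_intros continuous_shift[OF cpt] h) simp
  have le: "energy g (A a) \<le> 4 * (sup_energy g - energy g h)" if "cmod a = 1" for a
    unfolding A_def h_def by (rule near_optimal_symmetric[OF cpt u u1 that])
  have "h (x + y) - h y * h x = (1/2) * A 1 x + (\<i>/2) * A (-\<i>) x" for x
    unfolding A_def by (simp add: complex_eq_iff algebra_simps)
  then have "energy g (\<lambda>x. h (x + y) - h y * h x) = energy g (\<lambda>x. (1/2) * A 1 x + (\<i>/2) * A (-\<i>) x)"
    by simp
  also have "\<dots> \<le> 2 * energy g (\<lambda>x. (1/2) * A 1 x) + 2 * energy g (\<lambda>x. (\<i>/2) * A (-\<i>) x)"
    by (intro energy_add_le[OF cpt] continuous_intros A)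
  also have "\<dots> = 1/2 * energy g (A 1) + 1/2 * energy g (A (-\<i>))"
    by (simp only: energy_scale[OF cpt A]) (simp add: norm_divide power2_eq_square)
  also have "\<dots> \<le> 4 * (sup_energy g - energy g h)"
    using le[of 1] le[of "-\<i>"] by simp
  finally show ?thesis .
qed

text \<open>\<open>near_optimal\<close> controls the defect \<open>k y\<close> only in energy.
  Multiplied by \<open>h z\<close>, the defect at \<open>x, y\<close> is a combination of three such
  functions of \<open>z\<close>, and taking the energy in \<open>z\<close> pulls it out as a
  constant, which gives a pointwise bound.\<close>

lemma near_optimal_multiplicative:
  fixes u :: "'a \<Rightarrow> complex"
  assumes u: "continuous_on UNIV u" and u1: "autocorr u 0 = 1"
  defines "h \<equiv> autocorr u"
  shows "(cmod (h (x + y) - h x * h y))\<^sup>2 * energy g h \<le> 56 * (sup_energy g - energy g h)"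
proof -
  define k where "k y z = h (z + y) - h y * h z" for y z
  define e where "e = sup_energy g - energy g h"
  have h: "continuous_on UNIV h" unfolding h_def by (rule continuous_autocorr[OF cpt u])
  have k: "continuous_on UNIV (k y)" for y
    unfolding k_def by (intro continuous_intros continuous_shift[OF cpt] h)
  have le: "energy g (k y) \<le> 4 * e" for y
    unfolding k_def e_def h_def by (rule near_optimal[OF u u1])
  have hy: "(cmod (h y))\<^sup>2 \<le> 2"
    using norm_autocorr_le[OF cpt u, of y] u1 by (simp add: h_def)
  have e: "0 \<le> e" unfolding e_def h_def using energy_le_sup[OF cpt u u1] by simp
  have "(h (x + y) - h x * h y) * h z = (-1) * k (x + y) z + (k y (z + x) + h y * k x z)" for z
    unfolding k_def by (simp add: algebra_simps)
  then have "(cmod (h (x + y) - h x * h y))\<^sup>2 * energy g h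
     = energy g (\<lambda>z. (-1) * k (x + y) z + (k y (z + x) + h y * k x z))"
    by (simp flip: energy_scale[OF cpt h])
  also have "\<dots> \<le> 2 * energy g (\<lambda>z. (-1) * k (x + y) z) + 2 * energy g (\<lambda>z. k y (z + x) + h y * k x z)"
    by (intro energy_add_le[OF cpt] continuous_intros continuous_shift[OF cpt] k)
  also have "energy g (\<lambda>z. k y (z + x) + h y * k x z)
      \<le> 2 * energy g (\<lambda>z. k y (z + x)) + 2 * energy g (\<lambda>z. h y * k x z)"
    by (intro energy_add_le[OF cpt] continuous_intros continuous_shift[OF cpt] k)
  also have "energy g (\<lambda>z. (-1) * k (x + y) z) = energy g (k (x + y))"
    by (subst energy_scale[OF cpt k]) simp
  also have "energy g (\<lambda>z. k y (z + x)) = energy g (k y)"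
    by (rule energy_shift[OF cpt k])
  also have "energy g (\<lambda>z. h y * k x z) = (cmod (h y))\<^sup>2 * energy g (k x)"
    by (rule energy_scale[OF cpt k])
  also have "(cmod (h y))\<^sup>2 * energy g (k x) \<le> 2 * (4 * e)"
    by (intro mult_mono hy le energy_nonneg[OF cpt k]) simp
  \<comment> \<open>The constant is \<open>2 * 4 + 2 * (2 * 4 + 2 * 8) = 56\<close>.\<close>
  finally show ?thesis using le[of "x + y"] le[of y] by (simp add: e_def)
qed

text \<open>Powers of \<open>\<psi> x\<close> are again values of \<open>\<psi>\<close>, hence
  bounded, so the modulus is at most 1; the same at \<open>- x\<close> forces equality.\<close>

lemma bounded_multiplicative_norm_1:
  fixes \<psi> :: "'a \<Rightarrow> complex"
  assumes cont: "continuous_on UNIV \<psi>" and mult: "\<And>x y. \<psi> (x + y) = \<psi> x * \<psi> y" and nz: "\<And>x. \<psi> x \<noteq> 0"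
  shows "cmod (\<psi> x) = 1"
proof -
  have "continuous_on UNIV (\<lambda>x. cmod (\<psi> x))" by (intro continuous_intros cont)
  then obtain B where B: "\<And>x. \<bar>cmod (\<psi> x)\<bar> \<le> B" using continuous_bounded[OF cpt] by metis
  have zero: "\<psi> 0 = 1" using mult[of 0 0] nz[of 0] by simp
  have pow: "\<psi> (((+) x ^^ n) 0) = \<psi> x ^ n" for x n
    by (induction n) (simp_all add: zero mult)
  have le: "cmod (\<psi> x) \<le> 1" for x
  proof (rule ccontr)
    assume "\<not> cmod (\<psi> x) \<le> 1"
    then obtain n where "B < cmod (\<psi> x) ^ n" using real_arch_pow[of "cmod (\<psi> x)" B] by auto
    then show False using B[of "((+) x ^^ n) 0"] by (simp add: pow norm_power)
  qed
  have "cmod (\<psi> x) * cmod (\<psi> (- x)) = 1"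
    using mult[of x "- x"] zero by (simp flip: norm_mult)
  moreover have "cmod (\<psi> x) * cmod (\<psi> (- x)) \<le> cmod (\<psi> x) * 1"
    by (intro mult_left_mono le) simp
  ultimately show ?thesis using le[of x] by simp
qed

text \<open>The logarithm of \<open>h x * h y / h (x + y)\<close> is a small 2-cocycle; averaging it over one variable
  shows that it is a coboundary, which is then divided out.\<close>

lemma almost_character:
  fixes h :: "'a \<Rightarrow> complex"
  assumes h: "continuous_on UNIV h" and h0: "h 0 = 1"
    and mult: "\<And>x y. cmod (h (x + y) - h x * h y) \<le> d" and d: "d \<le> 1/16"
    and bd: "\<And>x. cmod (h x) \<le> 2"
  obtains \<psi> b where "circle_char \<psi>" "\<And>x. h x = \<psi> x * exp (b x)" "\<And>x. cmod (b x) \<le> 16 * d"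
proof -
  \<comment> \<open>The product \<open>h x * h (- x)\<close> is within \<open>1/16\<close> of
    \<open>h 0 = 1\<close>, and its second factor has modulus at most 2.\<close>
  have low: "1/4 \<le> cmod (h x)" for x
  proof -
    have "1 - cmod (h x) * cmod (h (- x)) \<le> d"
      using mult[of x "- x"] norm_triangle_ineq2[of 1 "h x * h (- x)"] by (simp add: h0 norm_mult)
    moreover have "cmod (h x) * cmod (h (- x)) \<le> cmod (h x) * 2"
      by (intro mult_left_mono bd) simp
    ultimately show ?thesis using d by linarith
  qed
  then have nz: "h x \<noteq> 0" for x by (metis norm_zero not_one_le_zero zero_less_divide_1_iff zero_less_numeral not_le)
  define q where "q x y = h x * h y / h (x + y)" for x y
  have q1: "cmod (q x y - 1) \<le> 4 * d" for x y
  proof -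
    have "q x y - 1 = - (h (x + y) - h x * h y) / h (x + y)"
      using nz[of "x + y"] by (simp add: q_def field_simps)
    then have "cmod (q x y - 1) = cmod (h (x + y) - h x * h y) / cmod (h (x + y))"
      by (simp only: norm_divide norm_minus_cancel)
    also have "\<dots> \<le> d / (1/4)"
      by (intro frac_le mult low order_trans[OF norm_ge_zero mult]) simp
    finally show ?thesis by simp
  qed
  define a where "a x y = Ln (q x y)" for x y
  have a_exp: "exp (a x y) = q x y" for x y
    using nz by (simp add: a_def q_def)
  have a_small: "cmod (a x y) \<le> 8 * d" for x y
  proof -
    have "cmod (Ln (1 + (q x y - 1))) \<le> 2 * cmod (q x y - 1)"
      using q1[of x y] d by (intro norm_Ln_le) linarith
    then show ?thesis using q1[of x y] by (simp add: a_def)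
  qed
  \<comment> \<open>Both sides have the same exponential; small imaginary parts exclude a difference
    by a nonzero multiple of \<open>2 * pi * \<i>\<close>.\<close>
  have cocycle: "a x y + a (x + y) z = a y z + a x (y + z)" for x y z
  proof (rule exp_complex_eqI)
    have im: "\<bar>Im (a x y)\<bar> \<le> 1/2" for x y
      using abs_Im_le_cmod[of "a x y"] a_small[of x y] d by linarith
    show "\<bar>Im (a x y + a (x + y) z) - Im (a y z + a x (y + z))\<bar> < 2 * pi"
      using im[of x y] im[of "x + y" z] im[of y z] im[of x "y + z"] pi_gt3
      unfolding plus_complex.simps by linarith
    show "exp (a x y + a (x + y) z) = exp (a y z + a x (y + z))"
      unfolding exp_add a_exp using nz by (simp add: q_def add.assoc)
  qed
  have "continuous_on UNIV (\<lambda>p. a (fst p) (snd p))"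
    unfolding a_def
  proof (rule continuous_on_Ln')
    show "continuous_on UNIV (\<lambda>p. q (fst p) (snd p))"
      unfolding q_def using nz
      by (intro continuous_intros continuous_on_compose2[OF h]) auto
    show "q (fst p) (snd p) \<notin> \<real>\<^sub>\<le>\<^sub>0" for p
    proof -
      have "\<bar>Re (q (fst p) (snd p) - 1)\<bar> \<le> 1/4"
        using abs_Re_le_cmod[of "q (fst p) (snd p) - 1"] q1[of "fst p" "snd p"] d by linarith
      then have "Re (q (fst p) (snd p)) > 0" unfolding minus_complex.simps one_complex.simps by linarith
      then show ?thesis by (auto simp: complex_nonpos_Reals_iff)
    qed
  qed
  note a_cont = this
  define b where "b x = cmean (a x)" for x
  have ax: "continuous_on UNIV (a x)" for x
    using continuous_on_compose2[OF a_cont, of UNIV "\<lambda>t. (x, t)"] by (simp add: continuous_intros)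
  have b_cont: "continuous_on UNIV b"
    unfolding b_def by (rule continuous_cmean[OF cpt a_cont])
  have b_small: "cmod (b x) \<le> 16 * d" for x
    using norm_cmean_le[OF cpt ax a_small, of x] by (simp add: b_def)
  \<comment> \<open>The cocycle identity is averaged over \<open>z\<close>; shift invariance turns
    the mean of \<open>a x (z + y)\<close> into \<open>b x\<close>.\<close>
  have coboundary: "a x y + b (x + y) = b y + b x" for x y
  proof -
    have "a x y + b (x + y) = cmean (\<lambda>z. a x y + a (x + y) z)"
      unfolding b_def by (subst cmean_add[OF cpt continuous_on_const ax]) (simp add: cmean_const[OF cpt])
    also have "\<dots> = cmean (\<lambda>z. a y z + a x (z + y))" unfolding cocycle by (simp add: add.commute)
    also have "\<dots> = b y + b x"
      unfolding b_def
      by (simp only: cmean_add[OF cpt ax continuous_shift[OF cpt ax]] cmean_shift[OF cpt ax])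
    finally show ?thesis .
  qed
  define \<psi> where "\<psi> x = h x * exp (- b x)" for x
  have "\<psi> (x + y) = \<psi> x * \<psi> y" for x y
  proof -
    have "h x * h y = h (x + y) * exp (a x y)" using nz[of "x + y"] by (simp add: a_exp q_def)
    then have "\<psi> x * \<psi> y = h (x + y) * exp (a x y + - b x + - b y)"
      unfolding exp_add by (simp add: \<psi>_def mult_ac)
    also have "a x y + - b x + - b y = - b (x + y)"
      using coboundary[of x y] by (simp add: algebra_simps)
    finally show ?thesis by (simp add: \<psi>_def)
  qed
  moreover have "continuous_on UNIV \<psi>"
    unfolding \<psi>_def by (intro continuous_intros h b_cont)
  moreover have "\<psi> x \<noteq> 0" for x by (simp add: \<psi>_def nz)
  ultimately have "circle_char \<psi>"
    unfolding circle_char_def using bounded_multiplicative_norm_1[of \<psi>] by blast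
  moreover have "h x = \<psi> x * exp (b x)" for x
    by (simp add: \<psi>_def flip: exp_add)
  ultimately show ?thesis using b_small that by blast
qed

text \<open>As \<open>u\<close> differs from its translate by \<open>g\<close>, the mean square of
  the difference is positive. Expanding it gives
  \<open>Re (autocorr u g) < Re (autocorr u 0)\<close>, so the autocorrelation is itself moved by
  \<open>g\<close>.\<close>

lemma sup_energy_pos:
  fixes u :: "'a \<Rightarrow> complex"
  assumes u: "continuous_on UNIV u" and ug: "u g \<noteq> u 0"
  shows "0 < sup_energy g"
proof -
  have uy: "continuous_on UNIV (\<lambda>t. u (t + g))" by (rule continuous_shift[OF cpt u])
  have "0 < mean (\<lambda>t. (cmod (u (t + g) - u t))\<^sup>2)"
    using ug by (intro mean_pos[OF cpt, of _ 0] continuous_intros u uy) auto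
  also have "(\<lambda>t. (cmod (u (t + g) - u t))\<^sup>2)
     = (\<lambda>t. 1 * (cmod (u (t + g)))\<^sup>2 + 1 * (cmod (u t))\<^sup>2 + (- 2) * Re (u (t + g) * cnj (u t)))"
    unfolding cmod_power2 by (simp add: fun_eq_iff power2_eq_square algebra_simps)
  also have "mean \<dots> = 1 * mean (\<lambda>t. (cmod (u (t + g)))\<^sup>2) + 1 * mean (\<lambda>t. (cmod (u t))\<^sup>2)
      + (- 2) * mean (\<lambda>t. Re (u (t + g) * cnj (u t)))"
    by (intro mean_lin3[OF cpt] continuous_intros u uy)
  also have "mean (\<lambda>t. (cmod (u (t + g)))\<^sup>2) = mean (\<lambda>t. (cmod (u t))\<^sup>2)"
    by (intro mean_shift[OF cpt, of "\<lambda>t. (cmod (u t))\<^sup>2"] continuous_intros u)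
  finally have "Re (autocorr u g) < Re (autocorr u 0)"
    by (simp add: autocorr_zero[OF cpt]) (simp add: autocorr_def)
  then have "autocorr u (0 + g) \<noteq> autocorr u 0" by auto
  then have "0 < energy g (autocorr u)"
    unfolding energy_def
    by (intro mean_pos[OF cpt, of _ 0] continuous_energy[OF cpt] continuous_autocorr[OF cpt] u) auto
  also have "\<dots> \<le> sup_energy g * (Re (autocorr u 0))\<^sup>2"
    by (rule energy_le_sup_scaled[OF cpt u])
  finally show ?thesis by (simp add: zero_less_mult_iff not_less)
qed

text \<open>A near-maximizer \<open>h\<close> of the energy is close to a character
  \<open>\<psi>\<close>. If \<open>\<psi> g\<close> were 1, then \<open>h\<close> would be almost
  invariant under \<open>g\<close> and its energy would fall below \<open>s / 2\<close>.\<close>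

lemma circle_char_separates_if:
  fixes u :: "'a \<Rightarrow> complex"
  assumes u: "continuous_on UNIV u" and ug: "u g \<noteq> u 0"
  shows "\<exists>\<psi>. circle_char \<psi> \<and> \<psi> g \<noteq> 1"
proof -
  define s where "s = sup_energy g"
  have s: "0 < s" unfolding s_def by (rule sup_energy_pos[OF u ug])
  \<comment> \<open>The energy will be bounded by \<open>6 * z\<^sup>2 = 3 * s / 8\<close>, which is
    below \<open>s / 2\<close>.\<close>
  define z where "z = sqrt s / 4"
  have z: "z > 0" "z\<^sup>2 = s / 16" using s by (simp_all add: z_def power_divide)
  have "isCont (exp :: complex \<Rightarrow> complex) 0" by simp
  then obtain n where n: "n > 0" "\<And>w. cmod w < n \<Longrightarrow> cmod (exp w - 1) < z"
    unfolding continuous_at_eps_delta using z(1) by (auto simp: dist_norm)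
  define d where "d = min (1/16) (min z (n / 17))"
  have d: "0 < d" "d \<le> 1/16" "d \<le> z" "16 * d < n"
    using z(1) n(1) by (auto simp: d_def min_def)
  \<comment> \<open>The first term keeps the energy of the near-maximizer above
    \<open>s / 2\<close>; the second makes \<open>56 * e\<close> at most
    \<open>d\<^sup>2 * (s / 2)\<close>, so that the multiplicative defect is at most
    \<open>d\<close>.\<close>
  define e where "e = min (s/2) (d\<^sup>2 * s / 112)"
  have e: "0 < e" "e \<le> s / 2" "112 * e \<le> d\<^sup>2 * s" using s d(1) by (auto simp: e_def min_def)
  have "autocorr (\<lambda>t::'a. 1) 0 = 1" by (simp add: autocorr_def cmean_const[OF cpt])
  then have ne: "{energy g (autocorr u) | u. continuous_on UNIV u \<and> autocorr u 0 = 1} \<noteq> {}"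
    using continuous_on_const by blast
  have "s - e < Sup {energy g (autocorr u) | u. continuous_on UNIV u \<and> autocorr u 0 = 1}"
    using e(1) by (simp add: s_def sup_energy_def)
  from less_cSupD[OF ne this] obtain v where
    v: "continuous_on UNIV v" "autocorr v 0 = 1" "s - e < energy g (autocorr v)"
    by blast
  define h where "h = autocorr v"
  have h: "continuous_on UNIV h" unfolding h_def by (rule continuous_autocorr[OF cpt v(1)])
  have hx: "(cmod (h x))\<^sup>2 \<le> 2" for x
    using norm_autocorr_le[OF cpt v(1), of x] v(2) by (simp add: h_def)
  have h0: "h 0 = 1" using v(2) by (simp add: h_def)
  have h2: "cmod (h x) \<le> 2" for x
  proof (rule power2_le_imp_le)
    show "(cmod (h x))\<^sup>2 \<le> 2\<^sup>2" by (rule order_trans[OF hx]) simp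
  qed simp
  have mult: "cmod (h (x + y) - h x * h y) \<le> d" for x y
  proof (rule power2_le_imp_le)
    have "(cmod (h (x + y) - h x * h y))\<^sup>2 * (s / 2) \<le> (cmod (h (x + y) - h x * h y))\<^sup>2 * energy g h"
      using v(3) e(2) by (intro mult_left_mono) (auto simp: h_def)
    also have "\<dots> \<le> 56 * e"
      using near_optimal_multiplicative[OF v(1,2), of x y g] v(3) by (simp add: h_def s_def)
    also have "\<dots> \<le> d\<^sup>2 * (s / 2)" using e(3) by simp
    finally show "(cmod (h (x + y) - h x * h y))\<^sup>2 \<le> d\<^sup>2" using s by simp
  qed (use d in simp)
  obtain \<psi> b where \<psi>: "circle_char \<psi>" "\<And>x. h x = \<psi> x * exp (b x)" "\<And>x. cmod (b x) \<le> 16 * d"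
    using almost_character[OF h h0 mult d(2) h2] by blast
  have "\<psi> g \<noteq> 1"
  proof
    assume "\<psi> g = 1"
    then have "cmod (h g - 1) < z"
      using n(2)[of "b g"] \<psi>(2)[of g] \<psi>(3)[of g] d(4) by simp
    then have hg: "(cmod (h g - 1))\<^sup>2 \<le> z\<^sup>2" by (intro power_mono) auto
    have "(cmod (h (x + g) - h x))\<^sup>2 \<le> 2 * d\<^sup>2 + 2 * (2 * z\<^sup>2)" for x
    proof -
      have "h (x + g) - h x = (h (x + g) - h x * h g) + h x * (h g - 1)" by (simp add: algebra_simps)
      then have "(cmod (h (x + g) - h x))\<^sup>2
          \<le> 2 * (cmod (h (x + g) - h x * h g))\<^sup>2 + 2 * (cmod (h x * (h g - 1)))\<^sup>2"
        by (simp only: parallelogram_ineq)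
      also have "\<dots> \<le> 2 * d\<^sup>2 + 2 * (2 * z\<^sup>2)"
        unfolding norm_mult power_mult_distrib
        by (intro add_mono mult_left_mono mult_mono hx hg power_mono mult) auto
      finally show ?thesis .
    qed
    then have "energy g h \<le> 2 * d\<^sup>2 + 2 * (2 * z\<^sup>2)"
      unfolding energy_def by (intro mean_le[OF cpt] continuous_energy[OF cpt] h)
    also have "\<dots> \<le> 6 * z\<^sup>2" using power_mono[OF d(3), of 2] d(1) by simp
    also have "\<dots> < s / 2" using z(2) s by simp
    finally show False using v(3) e(2) by (simp add: h_def)
  qed
  with \<psi>(1) show ?thesis by blast
qed

end

section \<open>Separation of points in the compact Hausdorff case\<close>

lemma compact_T2_separating_function:
  fixes a b :: "'a::t2_space"
  assumes cpt: "compact (UNIV :: 'a set)" and "a \<noteq> b"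
  obtains f :: "'a \<Rightarrow> real" where "continuous_on UNIV f" "f a \<noteq> f b"
proof -
  have "Hausdorff_space (euclidean :: 'a topology)"
    unfolding Hausdorff_space_def using hausdorff by (fastforce simp: disjnt_def)
  moreover have "compact_space (euclidean :: 'a topology)"
    using cpt by (simp add: compact_space_def)
  ultimately have "normal_space (euclidean :: 'a topology)"
    using compact_Hausdorff_or_regular_imp_normal_space by blast
  then obtain f where "continuous_map euclidean euclideanreal f" "f ` {a} \<subseteq> {0::real}" "f ` {b} \<subseteq> {1}"
    using \<open>a \<noteq> b\<close> by (rule_tac Urysohn_lemma_alt[of euclidean "{a}" "{b}" 0 1]) auto
  then show ?thesis using that[of f] by auto
qed

lemma circle_chars_separate:
  fixes g :: "'a::{topological_ab_group_add, t2_space}"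
  assumes cpt: "compact (UNIV :: 'a set)" and "g \<noteq> 0"
  shows "\<exists>\<psi>. circle_char \<psi> \<and> \<psi> g \<noteq> 1"
proof -
  obtain f :: "'a \<Rightarrow> real" where "continuous_on UNIV f" "f g \<noteq> f 0"
    using compact_T2_separating_function[OF assms] by blast
  then show ?thesis
    by (intro circle_char_separates_if[OF cpt, of "\<lambda>x. of_real (f x)"] continuous_intros) auto
qed

section \<open>Characters close to one on a finite set\<close>

lemma circle_char_zero: assumes "circle_char \<psi>" shows "\<psi> 0 = 1"
proof -
  have "\<psi> (0 + 0) = \<psi> 0 * \<psi> 0" "cmod (\<psi> 0) = 1"
    using assms unfolding circle_char_def by blast+
  then show ?thesis by (metis add_0 mult_cancel_left1 norm_zero zero_neq_one)
qed

lemma circle_char_norm: "circle_char \<psi> \<Longrightarrow> cmod (\<psi> x) = 1"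
  by (simp add: circle_char_def)

lemma circle_char_add: "circle_char \<psi> \<Longrightarrow> \<psi> (x + y) = \<psi> x * \<psi> y"
  by (simp add: circle_char_def)

lemma circle_char_minus:
  assumes "circle_char \<psi>" shows "\<psi> (- x) = cnj (\<psi> x)"
proof -
  have "\<psi> x * \<psi> (- x) = \<psi> x * cnj (\<psi> x)"
    using circle_char_add[OF assms, of x "- x"] circle_char_zero[OF assms]
      complex_norm_square[of "\<psi> x"] circle_char_norm[OF assms, of x] by simp
  moreover have "\<psi> x \<noteq> 0" using circle_char_norm[OF assms, of x] by auto
  ultimately show ?thesis by simp
qed

lemma circle_char_sum:
  assumes "circle_char \<psi>" "finite S" shows "\<psi> (\<Sum>h\<in>S. f h) = (\<Prod>h\<in>S. \<psi> (f h))"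
  using assms(2) by induction (simp_all add: circle_char_zero circle_char_add assms(1))

lemma circle_char_multiple:
  assumes "circle_char \<psi>" shows "\<psi> (((+) x ^^ n) 0) = \<psi> x ^ n"
  by (induction n) (simp_all add: circle_char_zero circle_char_add assms)

lemma circle_char_one: "circle_char (\<lambda>x. 1)"
  by (simp add: circle_char_def)

lemma circle_char_mult_power:
  "circle_char \<psi> \<Longrightarrow> circle_char \<phi> \<Longrightarrow> circle_char (\<lambda>x. \<psi> x * \<phi> x ^ n)"
  unfolding circle_char_def
  by (auto intro!: continuous_intros simp: norm_mult norm_power power_mult_distrib)

section \<open>Approximate orthogonality of characters\<close>

lemma sum_list_sum_swap:
  "(\<Sum>a\<leftarrow>as. \<Sum>i\<in>I. f a i) = (\<Sum>i\<in>I. \<Sum>a\<leftarrow>as. f a i)"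
  by (induction as) (simp_all add: sum.distrib)

lemma norm_sum_list_le:
  fixes f :: "'b \<Rightarrow> 'c::real_normed_vector"
  assumes "\<And>a. a \<in> set as \<Longrightarrow> norm (f a) \<le> B"
  shows "norm (\<Sum>a\<leftarrow>as. f a) \<le> real (length as) * B"
  using assms
proof (induction as)
  case (Cons a as)
  then have "norm (f a) + norm (\<Sum>a\<leftarrow>as. f a) \<le> B + real (length as) * B"
    by (intro add_mono) auto
  then show ?case
    using norm_triangle_ineq[of "f a" "\<Sum>a\<leftarrow>as. f a"] by (simp add: algebra_simps)
qed simp

text \<open>A finite substitute for the orthogonality relations. To add \<open>y0\<close>, the list
  is multiplied by the powers of a character \<open>\<phi>\<close> with
  \<open>\<phi> y0 \<noteq> 1\<close>: the geometric sum at \<open>y0\<close> is small relative to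
  its length, and the earlier bounds survive because \<open>\<phi>\<close> has modulus 1.\<close>

lemma almost_orthogonal_chars:
  fixes Y :: "'a::topological_ab_group_add set"
  assumes sep: "\<And>y. y \<in> Y \<Longrightarrow> \<exists>\<psi>. circle_char \<psi> \<and> \<psi> y \<noteq> 1"
    and "finite Y" and e: "e > 0"
  shows "\<exists>\<psi>s. \<psi>s \<noteq> [] \<and> (\<forall>\<psi>\<in>set \<psi>s. circle_char \<psi>)
           \<and> (\<forall>y\<in>Y. cmod (\<Sum>\<psi>\<leftarrow>\<psi>s. \<psi> y) \<le> real (length \<psi>s) * e)"
  using assms(2) sep
proof (induction Y rule: finite_induct)
  case empty
  show ?case by (intro exI[of _ "[\<lambda>x. 1]"]) (simp add: circle_char_one)
next
  case (insert y0 Y)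
  obtain \<psi>s where \<psi>s: "\<psi>s \<noteq> []" "\<And>\<psi>. \<psi> \<in> set \<psi>s \<Longrightarrow> circle_char \<psi>"
    "\<And>y. y \<in> Y \<Longrightarrow> cmod (\<Sum>\<psi>\<leftarrow>\<psi>s. \<psi> y) \<le> real (length \<psi>s) * e"
    using insert.IH insert.prems by (metis insert_iff)
  obtain \<phi> where \<phi>: "circle_char \<phi>" "\<phi> y0 \<noteq> 1" using insert.prems by blast
  \<comment> \<open>The geometric sum at \<open>y0\<close> is at most
    \<open>2 / cmod (\<phi> y0 - 1)\<close>, hence at most \<open>R * e\<close>.\<close>
  obtain R :: nat where R: "2 / (cmod (\<phi> y0 - 1) * e) < real R"
    using reals_Archimedean2 by blast
  have nz: "0 < cmod (\<phi> y0 - 1)" using \<phi>(2) by simp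
  have "0 < 2 / (cmod (\<phi> y0 - 1) * e)" using nz e by simp
  then have R0: "R > 0" using R by linarith
  define \<theta>s where "\<theta>s = concat (map (\<lambda>\<psi>. map (\<lambda>m x. \<psi> x * \<phi> x ^ m) [0..<R]) \<psi>s)"
  have len: "length \<theta>s = length \<psi>s * R"
    unfolding \<theta>s_def by (induction \<psi>s) simp_all
  have sum: "(\<Sum>\<theta>\<leftarrow>\<theta>s. \<theta> y) = (\<Sum>\<psi>\<leftarrow>\<psi>s. \<psi> y) * (\<Sum>m<R. \<phi> y ^ m)" for y
  proof -
    have "(\<Sum>m\<leftarrow>[0..<R]. c * \<phi> y ^ m) = c * (\<Sum>m<R. \<phi> y ^ m)" for c
      by (simp add: sum_list_const_mult interv_sum_list_conv_sum_set_nat atLeast0LessThan)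
    then show ?thesis
      unfolding \<theta>s_def by (induction \<psi>s) (simp_all add: comp_def distrib_right)
  qed
  have "cmod (\<Sum>\<theta>\<leftarrow>\<theta>s. \<theta> y) \<le> real (length \<theta>s) * e" if "y \<in> insert y0 Y" for y
  proof (cases "y = y0")
    case True
    have "cmod (\<Sum>\<psi>\<leftarrow>\<psi>s. \<psi> y0) \<le> real (length \<psi>s) * 1"
      by (rule norm_sum_list_le) (simp add: circle_char_norm \<psi>s(2))
    moreover have "cmod (\<Sum>m<R. \<phi> y0 ^ m) \<le> real R * e"
    proof -
      have "cmod (\<Sum>m<R. \<phi> y0 ^ m) * cmod (\<phi> y0 - 1) = cmod (\<phi> y0 ^ R - 1)"
        unfolding norm_mult[symmetric] using power_diff_1_eq[of "\<phi> y0" R] by (simp add: mult.commute)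
      also have "\<dots> \<le> cmod (\<phi> y0 ^ R) + cmod 1" by (rule norm_triangle_ineq4)
      also have "\<dots> = 2" by (simp add: norm_power circle_char_norm[OF \<phi>(1)])
      also have "\<dots> \<le> real R * e * cmod (\<phi> y0 - 1)" using R nz e by (simp add: field_simps)
      finally show ?thesis using nz by simp
    qed
    ultimately have "cmod (\<Sum>\<psi>\<leftarrow>\<psi>s. \<psi> y0) * cmod (\<Sum>m<R. \<phi> y0 ^ m)
        \<le> (real (length \<psi>s) * 1) * (real R * e)"
      by (intro mult_mono) auto
    then show ?thesis by (simp add: True sum len norm_mult)
  next
    case False
    then have "cmod (\<Sum>\<psi>\<leftarrow>\<psi>s. \<psi> y) \<le> real (length \<psi>s) * e" using \<psi>s(3) that by blast
    moreover have "cmod (\<Sum>m<R. \<phi> y ^ m) \<le> real R"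
      using sum_norm_le[of "{..<R}" "\<lambda>m. \<phi> y ^ m" "\<lambda>m. 1"]
      by (simp add: norm_power circle_char_norm[OF \<phi>(1)])
    ultimately have "cmod (\<Sum>\<psi>\<leftarrow>\<psi>s. \<psi> y) * cmod (\<Sum>m<R. \<phi> y ^ m)
        \<le> (real (length \<psi>s) * e) * real R"
      using e by (intro mult_mono) auto
    then show ?thesis by (simp add: sum len norm_mult mult_ac)
  qed
  moreover have "\<theta>s \<noteq> []" using len \<psi>s(1) R0 by auto
  moreover have "circle_char \<theta>" if "\<theta> \<in> set \<theta>s" for \<theta>
    using that circle_char_mult_power[OF \<psi>s(2) \<phi>(1)] by (auto simp: \<theta>s_def)
  ultimately show ?case by blast
qed

text \<open>Since \<open>\<psi> (y i) * cnj (\<psi> (y j)) * \<psi> x\<close> is a single value of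
  \<open>\<psi>\<close>, the weighted sum reduces to character sums at single points, where
  almost-orthogonality applies.\<close>

lemma sum_list_double_sum:
  fixes y :: "'i \<Rightarrow> 'a::topological_ab_group_add" and w :: "'i \<Rightarrow> real"
  assumes "\<And>\<psi>. \<psi> \<in> set \<psi>s \<Longrightarrow> circle_char \<psi>"
  shows "(\<Sum>\<psi>\<leftarrow>\<psi>s. (cmod (\<Sum>i\<in>I. of_real (w i) * \<psi> (y i)))\<^sup>2 * Re (\<psi> x))
    = (\<Sum>i\<in>I. \<Sum>j\<in>I. w i * w j * Re (\<Sum>\<psi>\<leftarrow>\<psi>s. \<psi> (y i - y j + x)))"
proof -
  have *: "(cmod (\<Sum>i\<in>I. of_real (w i) * \<psi> (y i)))\<^sup>2 * Re (\<psi> x)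
     = (\<Sum>i\<in>I. \<Sum>j\<in>I. w i * w j * Re (\<psi> (y i - y j + x)))" if "circle_char \<psi>" for \<psi>
  proof -
    have "of_real ((cmod (\<Sum>i\<in>I. of_real (w i) * \<psi> (y i)))\<^sup>2) * \<psi> x
      = (\<Sum>i\<in>I. \<Sum>j\<in>I. of_real (w i * w j) * \<psi> (y i - y j + x))"
      unfolding complex_norm_square cnj_sum sum_product
      unfolding sum_distrib_right
      by (intro sum.cong refl)
         (simp add: circle_char_add[OF that] circle_char_minus[OF that] diff_conv_add_uminus mult_ac
           del: add_uminus_conv_diff)
    from arg_cong[OF this, of Re] show ?thesis by simp
  qed
  have "(\<Sum>\<psi>\<leftarrow>\<psi>s. (cmod (\<Sum>i\<in>I. of_real (w i) * \<psi> (y i)))\<^sup>2 * Re (\<psi> x))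
    = (\<Sum>\<psi>\<leftarrow>\<psi>s. \<Sum>i\<in>I. \<Sum>j\<in>I. w i * w j * Re (\<psi> (y i - y j + x)))"
    using * assms by (intro arg_cong[where f = sum_list] map_cong refl) simp
  also have "\<dots> = (\<Sum>i\<in>I. \<Sum>j\<in>I. w i * w j * Re (\<Sum>\<psi>\<leftarrow>\<psi>s. \<psi> (y i - y j + x)))"
  proof -
    have "Re (\<Sum>\<psi>\<leftarrow>\<psi>s. \<psi> z) = (\<Sum>\<psi>\<leftarrow>\<psi>s. Re (\<psi> z))" for z
      by (induction \<psi>s) simp_all
    then show ?thesis
      unfolding sum_list_sum_swap by (simp add: sum_list_const_mult)
  qed
  finally show ?thesis .
qed

section \<open>Concentration of a trigonometric polynomial\<close>

lemma polynomial_times_power_null: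
  fixes q :: real
  assumes "0 < q" "q < 1"
  shows "(\<lambda>n. real (n + 1) ^ k * q ^ n) \<longlonglongrightarrow> 0"
proof -
  \<comment> \<open>With \<open>q = exp (- c)\<close> this is the decay of
    \<open>t ^ k / exp t\<close> at \<open>t = c * (n + 1)\<close>; the factor
    \<open>c ^ k * q\<close> absorbs the scaling and the shift by one.\<close>
  define c where "c = - ln q"
  have c: "c > 0" "exp (- c) = q" using assms by (simp_all add: c_def)
  have "filterlim (\<lambda>n. c * real (n + 1)) at_top sequentially"
    by (intro filterlim_tendsto_pos_mult_at_top[OF tendsto_const c(1)]
        filterlim_compose[OF filterlim_real_sequentially] filterlim_add_const_nat_at_top)
  from filterlim_compose[OF tendsto_power_div_exp_0 this]
  have "(\<lambda>n. (c * real (n + 1)) ^ k / exp (c * real (n + 1))) \<longlonglongrightarrow> 0" .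
  then have "(\<lambda>n. inverse (c ^ k * q) * ((c * real (n + 1)) ^ k / exp (c * real (n + 1)))) \<longlonglongrightarrow> 0"
    by (rule tendsto_mult_right_zero)
  moreover have "inverse (c ^ k * q) * ((c * real (n + 1)) ^ k / exp (c * real (n + 1)))
      = real (n + 1) ^ k * q ^ n" for n
  proof -
    have "inverse (exp (c * real (n + 1))) = exp (- c) ^ (n + 1)"
      by (simp add: algebra_simps flip: exp_minus exp_of_nat_mult exp_add)
    then have "inverse (exp (c * real (n + 1))) = q ^ (n + 1)" unfolding c(2) .
    then have "(c * real (n + 1)) ^ k / exp (c * real (n + 1)) = (c ^ k * real (n + 1) ^ k) * (q ^ n * q)"
      by (simp only: divide_inverse power_mult_distrib power_add power_one_right)
    moreover have "inverse (A * q) * ((A * B) * (C * q)) = B * C" if "A \<noteq> 0" for A B C :: real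
      using that assms(1) by (simp add: field_simps)
    moreover have "c ^ k \<noteq> 0" using c(1) by simp
    ultimately show ?thesis by (simp only: not_False_eq_True)
  qed
  ultimately show ?thesis by (simp only:)
qed

text \<open>This is the parallelogram law for 1 and \<open>z\<close>.\<close>

lemma norm_one_plus_half:
  assumes "cmod z = 1"
  shows "(cmod ((1 + z) / 2))\<^sup>2 = 1 - (cmod (z - 1))\<^sup>2 / 4"
proof -
  have "(Re z)\<^sup>2 + (Im z)\<^sup>2 = 1" using assms by (simp flip: cmod_power2)
  then show ?thesis
    unfolding norm_divide power_divide cmod_power2 by (simp add: power2_eq_square field_simps)
qed

text \<open>Binomial weights concentrate the trigonometric polynomial on the characters that are close
  to \<open>1\<close> on \<open>S\<close>: away from them it decays exponentially in \<open>N\<close>, whereas the number \<open>(N + 1) ^ card S\<close>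
  of its terms, which bounds its mean square from below, is polynomial in \<open>N\<close>.\<close>

lemma binomial_trig_polynomial:
  fixes S :: "'a::topological_ab_group_add set"
  assumes S: "finite S" and H: "is_subgroup H" "S \<subseteq> H"
  obtains I :: "('a \<Rightarrow> nat) set" and w y where
    "finite I" "card I = (N + 1) ^ card S" "\<And>i. 0 \<le> w i" "(\<Sum>i\<in>I. w i) = 1" "\<And>i. y i \<in> H"
    "\<And>\<psi>. circle_char \<psi> \<Longrightarrow>
       (\<Sum>i\<in>I. of_real (w i) * \<psi> (y i)) = (\<Prod>h\<in>S. ((1 + \<psi> h) / 2) ^ N)"
proof -
  \<comment> \<open>An index assigns to each \<open>h\<close> its exponent in the binomial
    expansion. Different indices may give the same \<open>y i\<close>: \<open>card I\<close> counts
    terms, not frequencies.\<close>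
  define I where "I = (\<Pi>\<^sub>E h\<in>S. {..N})"
  define w where "w i = (\<Prod>h\<in>S. real (N choose i h) / 2 ^ N)" for i
  define y where "y i = (\<Sum>h\<in>S. ((+) h ^^ i h) 0)" for i
  have mult: "((+) h ^^ n) 0 \<in> H" if "h \<in> H" for h n
    using H(1) that by (induction n) (auto simp: is_subgroup_def)
  have yH: "y i \<in> H" for i
    unfolding y_def using S H(2)
  proof (induction S rule: finite_induct)
    case (insert h S)
    then show ?case using H(1) mult[of h] by (auto simp: is_subgroup_def)
  qed (use H(1) in \<open>simp add: is_subgroup_def\<close>)
  have expand: "(\<Sum>i\<in>I. of_real (w i) * \<psi> (y i)) = (\<Prod>h\<in>S. ((1 + \<psi> h) / 2) ^ N)"
    if "circle_char \<psi>" for \<psi>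
  proof -
    have "((1 + z) / 2) ^ N = (\<Sum>m\<in>{..N}. of_real (real (N choose m) / 2 ^ N) * z ^ m)" for z :: complex
      using binomial_ring[of z 1 N]
      by (simp add: power_divide sum_divide_distrib add.commute)
    then have "(\<Prod>h\<in>S. ((1 + \<psi> h) / 2) ^ N)
      = (\<Sum>i\<in>I. \<Prod>h\<in>S. of_real (real (N choose i h) / 2 ^ N) * \<psi> h ^ i h)"
      unfolding I_def by (simp add: prod_sum_PiE S)
    also have "\<dots> = (\<Sum>i\<in>I. of_real (w i) * \<psi> (y i))"
      by (simp add: w_def y_def circle_char_sum[OF that S] circle_char_multiple[OF that]
          flip: prod.distrib)
    finally show ?thesis by simp
  qed
  have "of_real (\<Sum>i\<in>I. w i) = (1 :: complex)"
    using expand[OF circle_char_one] by simp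
  then have "(\<Sum>i\<in>I. w i) = 1" by (simp only: of_real_eq_1_iff)
  moreover have "finite I" "card I = (N + 1) ^ card S"
    unfolding I_def using S by (simp_all add: finite_PiE card_PiE)
  moreover have "0 \<le> w i" for i unfolding w_def by (intro prod_nonneg) auto
  ultimately show ?thesis using that yH expand by blast
qed

text \<open>Otherwise \<open>Re (\<psi> x) \<ge> 1/2\<close> wherever the squared polynomial
  \<open>P\<close> is not tiny, so \<open>P\<close> correlates with \<open>\<psi> x\<close>.
  Averaged over an almost orthogonal list of characters, \<open>P\<close> is at least about
  \<open>1 / L\<close> with \<open>L\<close> the number of terms, whereas
  \<open>P \<psi> * Re (\<psi> x)\<close> averages to at most \<open>e\<close>.\<close>

lemma char_near_one_on_finite:
  fixes H :: "'a::topological_ab_group_add set"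
  assumes sep: "\<And>y::'a. y \<noteq> 0 \<Longrightarrow> \<exists>\<psi>. circle_char \<psi> \<and> \<psi> y \<noteq> 1"
    and H: "is_subgroup H" and S: "finite S" "S \<subseteq> H" and x: "x \<notin> H" and "d > 0"
  shows "\<exists>\<psi>. circle_char \<psi> \<and> (\<forall>h\<in>S. cmod (\<psi> h - 1) < d) \<and> 1 \<le> cmod (\<psi> x - 1)"
proof (rule ccontr)
  assume "\<not> ?thesis"
  then have contra: "cmod (\<psi> x - 1) < 1" if "circle_char \<psi>" "\<forall>h\<in>S. cmod (\<psi> h - 1) < d" for \<psi>
    using that by force
  \<comment> \<open>Capping \<open>c\<close> at 1 keeps \<open>q\<close> positive. By
    \<open>norm_one_plus_half\<close>, \<open>q\<close> bounds the squared modulus of a factor with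
    \<open>cmod (\<psi> h - 1) \<ge> d\<close>.\<close>
  define c where "c = min d 1"
  define q where "q = 1 - c\<^sup>2 / 4"
  have c: "0 < c" "c \<le> d" "c\<^sup>2 \<le> 1"
    using \<open>d > 0\<close> by (auto simp: c_def intro!: power_le_one)
  have q: "0 < q" "q < 1" unfolding q_def using c by simp_all
  have "\<forall>\<^sub>F N in sequentially. real (N + 1) ^ card S * q ^ N < 1/6"
    by (rule order_tendstoD(2)[OF polynomial_times_power_null[OF q]]) simp
  then obtain N where N: "real (N + 1) ^ card S * q ^ N < 1/6"
    using eventually_happens'[OF sequentially_bot] by blast
  obtain I :: "('a \<Rightarrow> nat) set" and w :: "('a \<Rightarrow> nat) \<Rightarrow> real" and y :: "('a \<Rightarrow> nat) \<Rightarrow> 'a"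
    where I: "finite I" "card I = (N + 1) ^ card S"
    and w: "\<And>i. 0 \<le> w i" "(\<Sum>i\<in>I. w i) = 1" and y: "\<And>i. y i \<in> H"
    and D: "\<And>\<psi>. circle_char \<psi> \<Longrightarrow>
       (\<Sum>i\<in>I. of_real (w i) * \<psi> (y i)) = (\<Prod>h\<in>S. ((1 + \<psi> h) / 2) ^ N)"
    by (rule binomial_trig_polynomial[OF S(1) H S(2), of N]) (rule that)
  define L where "L = real (card I)"
  have L: "L > 0" "L * q ^ N < 1/6" using N by (simp_all add: L_def I(2))
  \<comment> \<open>Multiplied by \<open>L\<close>, the final inequality reads
    \<open>7/16 \<le> 1/8 + 3/2 * (L * q ^ N)\<close>, whose right side is below \<open>3/8\<close>
    by the choice of \<open>N\<close>.\<close>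
  define e where "e = 1 / (8 * L)"
  have e: "e > 0" using L by (simp add: e_def)
  define P where "P \<psi> = (cmod (\<Sum>i\<in>I. of_real (w i) * \<psi> (y i)))\<^sup>2" for \<psi>
  \<comment> \<open>The differences serve the lower bound and their shifts by \<open>x\<close> the
    upper one; 0 is removed because no character is nontrivial there.\<close>
  define Y where "Y = ((\<lambda>(i, j). y i - y j) ` (I \<times> I) \<union> (\<lambda>(i, j). y i - y j + x) ` (I \<times> I)) - {0}"
  have "finite Y" unfolding Y_def using I(1) by simp
  have "\<exists>\<psi>s. \<psi>s \<noteq> [] \<and> (\<forall>\<psi>\<in>set \<psi>s. circle_char \<psi>)
           \<and> (\<forall>y\<in>Y. cmod (\<Sum>\<psi>\<leftarrow>\<psi>s. \<psi> y) \<le> real (length \<psi>s) * e)"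
    by (rule almost_orthogonal_chars[OF sep \<open>finite Y\<close> e]) (simp add: Y_def)
  then obtain \<psi>s where \<psi>s: "\<psi>s \<noteq> []" "\<And>\<psi>. \<psi> \<in> set \<psi>s \<Longrightarrow> circle_char \<psi>"
    "\<And>y. y \<in> Y \<Longrightarrow> cmod (\<Sum>\<psi>\<leftarrow>\<psi>s. \<psi> y) \<le> real (length \<psi>s) * e"
    by blast
  define n where "n = real (length \<psi>s)"
  have n: "n > 0" using \<psi>s(1) by (simp add: n_def)
  have W: "(\<Sum>i\<in>I. \<Sum>j\<in>I. w i * w j) = 1"
    using w(2) by (simp flip: sum_product)
  \<comment> \<open>As \<open>x \<notin> H\<close>, the double sum shifted by \<open>x\<close> has
    no diagonal terms.\<close>
  have shift: "y i - y j + x \<noteq> 0" for i j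
  proof
    assume "y i - y j + x = 0"
    then have "x = y j + - y i" by (simp add: algebra_simps eq_neg_iff_add_eq_0)
    moreover have "y j + - y i \<in> H" using y H unfolding is_subgroup_def by blast
    ultimately show False using x by simp
  qed
  have expand: "(\<Sum>\<psi>\<leftarrow>\<psi>s. P \<psi> * Re (\<psi> z))
      = (\<Sum>i\<in>I. \<Sum>j\<in>I. w i * w j * Re (\<Sum>\<psi>\<leftarrow>\<psi>s. \<psi> (y i - y j + z)))" for z
    unfolding P_def by (rule sum_list_double_sum) (rule \<psi>s(2))
  have upper: "(\<Sum>\<psi>\<leftarrow>\<psi>s. P \<psi> * Re (\<psi> x)) \<le> n * e"
  proof -
    have "(\<Sum>\<psi>\<leftarrow>\<psi>s. P \<psi> * Re (\<psi> x)) \<le> (\<Sum>i\<in>I. \<Sum>j\<in>I. w i * w j * (n * e))"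
      unfolding expand
    proof (intro sum_mono mult_left_mono)
      fix i j assume "i \<in> I" "j \<in> I"
      then have "y i - y j + x \<in> Y" using shift by (auto simp: Y_def)
      from order_trans[OF complex_Re_le_cmod \<psi>s(3)[OF this]]
      show "Re (\<Sum>\<psi>\<leftarrow>\<psi>s. \<psi> (y i - y j + x)) \<le> n * e" by (simp add: n_def)
    qed (simp add: w)
    also have "\<dots> = n * e" unfolding sum_distrib_right[symmetric] W by simp
    finally show ?thesis .
  qed
  have lower: "n * (1 / L - e) \<le> (\<Sum>\<psi>\<leftarrow>\<psi>s. P \<psi>)"
  proof -
    \<comment> \<open>Cauchy-Schwarz for weights with sum 1.\<close>
    have "1 \<le> (\<Sum>i\<in>I. (w i)\<^sup>2) * L"
      using sum_squared_le_sum_of_squares[of w I] w(2) by (simp add: L_def)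
    then have "1 / L \<le> (\<Sum>i\<in>I. (w i)\<^sup>2)" using L(1) by (simp add: field_simps)
    then have "n * (1 / L - e) \<le> n * ((\<Sum>i\<in>I. (w i)\<^sup>2) - e)" using n by simp
    \<comment> \<open>Only the diagonal is counted: terms with \<open>y i = y j\<close> but
      \<open>i \<noteq> j\<close> contribute a nonnegative amount.\<close>
    also have "\<dots> = (\<Sum>i\<in>I. \<Sum>j\<in>I. w i * w j * ((if i = j then n else 0) - n * e))"
    proof -
      have "(\<Sum>i\<in>I. \<Sum>j\<in>I. w i * w j * ((if i = j then n else 0) - n * e))
        = (\<Sum>i\<in>I. \<Sum>j\<in>I. (if i = j then w i * w j * n else 0)) - (\<Sum>i\<in>I. \<Sum>j\<in>I. w i * w j * (n * e))"
        unfolding sum_subtractf[symmetric] by (intro sum.cong refl) (simp add: algebra_simps)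
      also have "(\<Sum>i\<in>I. \<Sum>j\<in>I. w i * w j * (n * e)) = n * e"
        unfolding sum_distrib_right[symmetric] W by simp
      also have "(\<Sum>i\<in>I. \<Sum>j\<in>I. (if i = j then w i * w j * n else 0)) = n * (\<Sum>i\<in>I. (w i)\<^sup>2)"
        using I(1) by (simp add: sum_distrib_left power2_eq_square mult_ac)
      finally show ?thesis by (simp add: algebra_simps)
    qed
    also have "\<dots> \<le> (\<Sum>i\<in>I. \<Sum>j\<in>I. w i * w j * Re (\<Sum>\<psi>\<leftarrow>\<psi>s. \<psi> (y i - y j + 0)))"
    proof (intro sum_mono mult_left_mono)
      fix i j assume ij: "i \<in> I" "j \<in> I"
      show "(if i = j then n else 0) - n * e \<le> Re (\<Sum>\<psi>\<leftarrow>\<psi>s. \<psi> (y i - y j + 0))"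
      proof (cases "y i = y j")
        case True
        have "(\<Sum>\<psi>\<leftarrow>\<psi>s. \<psi> 0) = (\<Sum>\<psi>\<leftarrow>\<psi>s. 1)"
          using \<psi>s(2) by (intro arg_cong[where f = sum_list] map_cong refl) (simp add: circle_char_zero)
        then have "Re (\<Sum>\<psi>\<leftarrow>\<psi>s. \<psi> (y i - y j + 0)) = n"
          using True by (simp add: n_def sum_list_triv)
        moreover have "0 \<le> n * e" using n e by simp
        ultimately show ?thesis using n by auto
      next
        case False
        then have "y i - y j \<in> Y" using ij by (auto simp: Y_def)
        from order_trans[OF abs_Re_le_cmod \<psi>s(3)[OF this]]
        have "\<bar>Re (\<Sum>\<psi>\<leftarrow>\<psi>s. \<psi> (y i - y j + 0))\<bar> \<le> n * e"
          unfolding n_def add_0_right .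
        moreover have "i \<noteq> j" using False by auto
        ultimately show ?thesis unfolding abs_le_iff by simp
      qed
    qed (simp add: w)
    also have "\<dots> = (\<Sum>\<psi>\<leftarrow>\<psi>s. P \<psi> * Re (\<psi> 0))"
      by (rule expand[symmetric])
    also have "\<dots> = (\<Sum>\<psi>\<leftarrow>\<psi>s. P \<psi>)"
      using \<psi>s(2) by (intro arg_cong[where f = sum_list] map_cong refl) (simp add: circle_char_zero)
    finally show ?thesis .
  qed
  \<comment> \<open>If \<open>\<psi>\<close> is near 1 on \<open>S\<close>, then
    \<open>cmod (\<psi> x - 1) < 1\<close> gives \<open>Re (\<psi> x) \<ge> 1/2\<close>. Otherwise
    \<open>P \<psi> \<le> q ^ N\<close>, and \<open>Re (\<psi> x) \<ge> -1\<close> costs at most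
    \<open>(1/2 + 1) * q ^ N\<close>.\<close>
  have pointwise: "(1/2) * P \<psi> \<le> P \<psi> * Re (\<psi> x) + (3/2) * q ^ N" if \<psi>: "circle_char \<psi>" for \<psi>
  proof (cases "\<forall>h\<in>S. cmod (\<psi> h - 1) < d")
    case True
    have "(Re (\<psi> x))\<^sup>2 + (Im (\<psi> x))\<^sup>2 = 1" using circle_char_norm[OF \<psi>, of x] by (simp flip: cmod_power2)
    moreover have "(cmod (\<psi> x - 1))\<^sup>2 \<le> 1"
      using contra[OF \<psi> True] by (intro power_le_one) auto
    ultimately have "1/2 \<le> Re (\<psi> x)"
      unfolding cmod_power2 by (simp add: power2_eq_square algebra_simps)
    then have "P \<psi> * (1/2) \<le> P \<psi> * Re (\<psi> x)" by (intro mult_left_mono) (simp_all add: P_def)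
    moreover have "0 \<le> q ^ N" using q(1) by simp
    ultimately show ?thesis by linarith
  next
    case False
    then obtain h where h: "h \<in> S" "d \<le> cmod (\<psi> h - 1)"
      unfolding not_le[symmetric] by blast
    have half: "(cmod ((1 + \<psi> k) / 2))\<^sup>2 = 1 - (cmod (\<psi> k - 1))\<^sup>2 / 4" for k
      by (rule norm_one_plus_half[OF circle_char_norm[OF \<psi>]])
    have "P \<psi> = (\<Prod>k\<in>S. ((cmod ((1 + \<psi> k) / 2))\<^sup>2) ^ N)"
      unfolding P_def D[OF \<psi>]
      by (simp add: norm_power prod_power_distrib mult.commute flip: prod_norm power_mult)
    also have "\<dots> = ((cmod ((1 + \<psi> h) / 2))\<^sup>2) ^ N * (\<Prod>k\<in>S - {h}. ((cmod ((1 + \<psi> k) / 2))\<^sup>2) ^ N)"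
      by (rule prod.remove[OF S(1) h(1)])
    also have "\<dots> \<le> q ^ N * 1"
    proof (intro mult_mono power_mono prod_le_1 conjI)
      have "c\<^sup>2 \<le> (cmod (\<psi> h - 1))\<^sup>2" using h(2) c by (intro power_mono) auto
      then show "(cmod ((1 + \<psi> h) / 2))\<^sup>2 \<le> q" unfolding half q_def by simp
      show "((cmod ((1 + \<psi> k) / 2))\<^sup>2) ^ N \<le> 1" for k
      proof (rule power_le_one)
        show "(cmod ((1 + \<psi> k) / 2))\<^sup>2 \<le> 1" unfolding half by simp
      qed simp
    qed (use q in \<open>auto intro!: prod_nonneg\<close>)
    finally have "P \<psi> \<le> q ^ N" by simp
    moreover
    from abs_Re_le_cmod[of "\<psi> x"] have "\<bar>Re (\<psi> x)\<bar> \<le> 1"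
      unfolding circle_char_norm[OF \<psi>] .
    then have "- 1 \<le> Re (\<psi> x)" by (simp add: abs_le_iff)
    then have "P \<psi> * (- 1) \<le> P \<psi> * Re (\<psi> x)" by (intro mult_left_mono) (simp_all add: P_def)
    ultimately show ?thesis by linarith
  qed
  have "(1/2) * (n * (1 / L - e)) \<le> (1/2) * (\<Sum>\<psi>\<leftarrow>\<psi>s. P \<psi>)" using lower by simp
  also have "\<dots> = (\<Sum>\<psi>\<leftarrow>\<psi>s. (1/2) * P \<psi>)" by (rule sum_list_const_mult[symmetric])
  also have "\<dots> \<le> (\<Sum>\<psi>\<leftarrow>\<psi>s. P \<psi> * Re (\<psi> x) + (3/2) * q ^ N)"
    using \<psi>s(2) by (intro sum_list_mono pointwise)
  also have "\<dots> = (\<Sum>\<psi>\<leftarrow>\<psi>s. P \<psi> * Re (\<psi> x)) + n * ((3/2) * q ^ N)"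
    by (simp add: sum_list_addf sum_list_triv n_def)
  also have "\<dots> \<le> n * e + n * ((3/2) * q ^ N)" using upper by simp
  finally have "n * ((1/2) * (1 / L - e)) \<le> n * (e + (3/2) * q ^ N)"
    by (simp only: distrib_left mult.left_commute)
  then have "(1/2) * (1 / L - e) \<le> e + (3/2) * q ^ N"
    using n by (simp only: mult_le_cancel_left_pos)
  then have "L * ((1/2) * (1 / L - e)) \<le> L * (e + (3/2) * q ^ N)"
    by (rule mult_left_mono) (use L(1) in simp)
  also have "\<dots> = L * e + (3/2) * (L * q ^ N)"
    by (simp only: distrib_left mult.left_commute)
  also have "L * ((1/2) * (1 / L - e)) = (1/2) * (L * (1 / L) - L * e)"
    by (simp only: right_diff_distrib mult.left_commute)
  finally show False using L(2) \<open>L > 0\<close> by (simp add: e_def)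
qed

section \<open>Characters into the circle group\<close>

lift_definition expT :: "real_mod_Z \<Rightarrow> complex" is "\<lambda>t. cis (2 * pi * t)"
proof -
  fix s t :: real assume "s - t \<in> \<int>"
  then have "cis (2 * pi * (s - t)) = 1" by (simp add: cis_multiple_2pi)
  moreover have "cis (2 * pi * s) = cis (2 * pi * (s - t)) * cis (2 * pi * t)"
    by (simp add: cis_mult algebra_simps)
  ultimately show "cis (2 * pi * s) = cis (2 * pi * t)" by simp
qed

text \<open>Inverse of \<open>expT\<close> on the unit circle; the jump of \<open>Arg\<close> on the
  negative real axis disappears modulo the integers.\<close>

definition argT :: "complex \<Rightarrow> real_mod_Z" where
  "argT z = class_mod_Z (Arg z / (2 * pi))"

lemma continuous_class_mod_Z: "continuous_on UNIV class_mod_Z"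
  by (simp add: continuous_on_open_vimage open_real_mod_Z_def)

lemma expT_add: "expT (s + t) = expT s * expT t"
  by transfer (simp add: cis_mult algebra_simps)

lemma expT_zero [simp]: "expT 0 = 1"
  by transfer simp

lemma inj_expT: "inj expT"
proof (rule injI)
  show "expT s = expT t \<Longrightarrow> s = t" for s t
  proof transfer
    fix s t :: real assume "cis (2 * pi * s) = cis (2 * pi * t)"
    then have "exp (\<i> * of_real (2 * pi * s)) = exp (\<i> * of_real (2 * pi * t))"
      by (simp add: cis_conv_exp)
    then obtain n :: int where "2 * pi * s = 2 * pi * t + of_int (2 * n) * pi"
      unfolding exp_eq by (auto simp: complex_eq_iff)
    then have "pi * (2 * (s - t - of_int n)) = 0" by (simp add: algebra_simps)
    then have "s - t = of_int n" by simp
    then show "s - t \<in> \<int>" by simp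
  qed
qed

lemma continuous_expT: "continuous_on UNIV expT"
  unfolding continuous_on_open_vimage[OF open_UNIV]
proof (intro allI impI)
  fix U :: "complex set" assume "open U"
  then have "open ((\<lambda>t. cis (2 * pi * t)) -` U)"
    by (intro open_vimage continuous_intros)
  moreover have "class_mod_Z -` (expT -` U) = (\<lambda>t. cis (2 * pi * t)) -` U"
    by (auto simp: expT.abs_eq)
  ultimately show "open (expT -` U \<inter> UNIV)" by (simp add: open_real_mod_Z_def)
qed

lemma expT_argT: "cmod z = 1 \<Longrightarrow> expT (argT z) = z"
  unfolding argT_def expT.abs_eq using cis_Arg[of z] by (cases "z = 0") (simp_all add: sgn_div_norm)

lemma argT_one: "argT 1 = 0"
  by (rule injD[OF inj_expT]) (simp add: expT_argT)

lemma argT_mult: "cmod z = 1 \<Longrightarrow> cmod w = 1 \<Longrightarrow> argT (z * w) = argT z + argT w"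
  by (rule injD[OF inj_expT]) (simp add: expT_argT expT_add norm_mult)

lemma continuous_argT: "continuous_on (sphere 0 1) argT"
  unfolding continuous_on_def
proof
  fix z0 :: complex assume z0: "z0 \<in> sphere 0 1"
  then have nz: "z0 \<noteq> 0" by auto
  \<comment> \<open>Rotating by \<open>z0\<close> moves the evaluation of \<open>Arg\<close> to 1,
    where it is continuous; adding back \<open>Arg z0\<close> changes \<open>argT z\<close> only by
    an integer before passing to the quotient.\<close>
  define G where "G z = class_mod_Z (Arg (z / z0) / (2 * pi) + Arg z0 / (2 * pi))" for z
  have G: "G z = argT z" if "z \<in> sphere 0 1" for z
  proof (rule injD[OF inj_expT])
    have "G z = argT (z / z0) + argT z0"
      by (simp add: G_def argT_def plus_real_mod_Z.abs_eq)
    then show "expT (G z) = expT (argT z)"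
      using that z0 nz by (simp add: expT_add expT_argT norm_divide)
  qed
  have "isCont Arg 1" by (rule continuous_at_Arg) simp
  moreover have "((\<lambda>z. z / z0) \<longlongrightarrow> z0 / z0) (at z0 within sphere 0 1)"
    by (intro tendsto_intros nz)
  then have "((\<lambda>z. z / z0) \<longlongrightarrow> 1) (at z0 within sphere 0 1)" using nz by simp
  ultimately have "((\<lambda>z. Arg (z / z0)) \<longlongrightarrow> Arg 1) (at z0 within sphere 0 1)"
    by (rule isCont_tendsto_compose)
  then have "((\<lambda>z. Arg (z / z0) / (2 * pi) + Arg z0 / (2 * pi)) \<longlongrightarrow> Arg (z0 / z0) / (2 * pi) + Arg z0 / (2 * pi))
     (at z0 within sphere 0 1)"
    using nz by (intro tendsto_intros) auto
  then have "(G \<longlongrightarrow> G z0) (at z0 within sphere 0 1)"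
    unfolding G_def
    by (intro continuous_on_tendsto_compose[OF continuous_class_mod_Z]) auto
  then show "(argT \<longlongrightarrow> argT z0) (at z0 within sphere 0 1)"
    unfolding G[OF z0]
    by (rule Lim_transform_eventually) (auto simp: eventually_at_topological G intro!: exI[of _ UNIV])
qed

lemma argT_circle_char:
  assumes "circle_char \<psi>" shows "(\<lambda>x. argT (\<psi> x)) \<in> characters"
  using assms argT_mult unfolding characters_def circle_char_def
  by (auto intro!: continuous_on_compose2[OF continuous_argT])

lemma argT_tendsto_zero_iff:
  fixes f :: "nat \<Rightarrow> complex"
  assumes "\<And>n. cmod (f n) = 1"
  shows "(\<lambda>n. argT (f n)) \<longlonglongrightarrow> 0 \<longleftrightarrow> f \<longlonglongrightarrow> 1"
proof
  assume "(\<lambda>n. argT (f n)) \<longlonglongrightarrow> 0"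
  then have "(\<lambda>n. expT (argT (f n))) \<longlonglongrightarrow> expT 0"
    by (intro continuous_on_tendsto_compose[OF continuous_expT]) auto
  then show "f \<longlonglongrightarrow> 1" by (simp add: expT_argT assms)
next
  assume "f \<longlonglongrightarrow> 1"
  then have "(\<lambda>n. argT (f n)) \<longlonglongrightarrow> argT 1"
    by (intro continuous_on_tendsto_compose[OF continuous_argT]) (auto simp: assms)
  then show "(\<lambda>n. argT (f n)) \<longlonglongrightarrow> 0" by (simp add: argT_one)
qed

section \<open>Separating a point from a countable subgroup\<close>

lemma basic_g_closed_separating:
  fixes H :: "'a::{topological_ab_group_add, t2_space} set"
  assumes cpt: "compact (UNIV :: 'a set)" and H: "is_subgroup H" "countable H" and x: "x \<notin> H"
  shows "\<exists>B. basic_g_closed B \<and> H \<subseteq> B \<and> x \<notin> B"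
proof -
  have ne: "H \<noteq> {}" using H(1) by (auto simp: is_subgroup_def)
  \<comment> \<open>For finite \<open>H\<close> this enumeration repeats elements, so finite and
    infinite \<open>H\<close> are treated alike.\<close>
  define h where "h = from_nat_into H"
  have hH: "h i \<in> H" for i unfolding h_def by (rule from_nat_into[OF ne])
  have "\<exists>\<psi>. circle_char \<psi> \<and> (\<forall>k\<in>h ` {..n}. cmod (\<psi> k - 1) < 1 / real (Suc n)) \<and> 1 \<le> cmod (\<psi> x - 1)" for n
    by (rule char_near_one_on_finite[OF circle_chars_separate[OF cpt] H(1)]) (use hH x in auto)
  then obtain \<psi> where \<psi>: "\<And>n. circle_char (\<psi> n)"
    "\<And>n k. k \<in> h ` {..n} \<Longrightarrow> cmod (\<psi> n k - 1) < 1 / real (Suc n)" "\<And>n. 1 \<le> cmod (\<psi> n x - 1)"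
    by metis
  define B where "B = null_subgroup (\<lambda>n y. argT (\<psi> n y))"
  have B: "y \<in> B \<longleftrightarrow> (\<lambda>n. \<psi> n y) \<longlonglongrightarrow> 1" for y
    by (simp add: B_def null_subgroup_def argT_tendsto_zero_iff circle_char_norm \<psi>(1))
  have "basic_g_closed B"
    unfolding basic_g_closed_def B_def
    by (intro exI[of _ "\<lambda>n y. argT (\<psi> n y)"] conjI allI refl argT_circle_char \<psi>(1))
  moreover have "H \<subseteq> B"
  proof
    fix y assume "y \<in> H"
    then obtain i where i: "y = h i" unfolding h_def using from_nat_into_surj[OF H(2)] by metis
    have "\<forall>\<^sub>F n in sequentially. cmod (\<psi> n y - 1) \<le> 1 / real (Suc n)"
      using eventually_ge_at_top[of i]
      by eventually_elim (rule less_imp_le, rule \<psi>(2), use i in auto)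
    then have "(\<lambda>n. \<psi> n y - 1) \<longlonglongrightarrow> 0"
      by (rule Lim_null_comparison) (use LIMSEQ_inverse_real_of_nat in \<open>simp add: inverse_eq_divide\<close>)
    then show "y \<in> B" unfolding B by (rule LIM_zero_cancel)
  qed
  moreover have "x \<notin> B"
  proof
    assume "x \<in> B"
    then have "(\<lambda>n. cmod (\<psi> n x - 1)) \<longlonglongrightarrow> cmod (1 - 1)"
      unfolding B by (rule tendsto_norm[OF tendsto_diff[OF _ tendsto_const]])
    then have "1 \<le> cmod (1 - 1 :: complex)" by (rule LIMSEQ_le_const) (use \<psi>(3) in auto)
    then show False by simp
  qed
  ultimately show ?thesis by blast
qed

theorem theorem3p6:
  fixes H :: "'a::{topological_ab_group_add, t2_space} set"
  assumes "compact (UNIV :: 'a set)"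
    and "infinite (UNIV :: 'a set)"
    and "is_subgroup H"
    and "countable H"
  shows "g_closed H"
proof -
  have "H = \<Inter> {B. basic_g_closed B \<and> H \<subseteq> B}"
    using basic_g_closed_separating[OF assms(1,3,4)] by blast
  then show ?thesis
    unfolding g_closed_def using assms(3)
    by (intro conjI exI[of _ "{B. basic_g_closed B \<and> H \<subseteq> B}"]) simp_all
qed

end
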